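(* Let $\mathbf t=(t_1,\ldots,t_n)^\top\in(0,+\infty)^n$, $t=\sum_{j=1}^nt_j$, and let $\Delta\in\mathcal M^{\geq}$ have eigenvalues $\lambda_1\geq\ldots\geq\lambda_n$. (i) If $\Delta$ is not invertible, then $\iota(\Delta;\mathcal S_{\mathbf t})=0$, and the infimum is attained if and only if $\Delta=0$. (ii) Suppose that $t_1\geq t_2\geq\ldots\geq t_n$. If $\Delta$ is invertible, then $$m(\Delta;\mathcal S_{\mathbf t})=t\left(\prod_{j=1}^n(\lambda_{n-j+1}t_j^{-1})^{t_j}\right)^{1/t}$$ and $$\mathcal S_{\mathbf t}(\Delta)=\left\{t^{-1/2}\,m(\Delta;\mathcal S_{\mathbf t})^{1/2}\,V\,\mathrm{diag}\left((t_1\lambda_n^{-1})^{1/2},(t_2\lambda_{n-1}^{-1})^{1/2},\ldots,(t_n\lambda_1^{-1})^{1/2}\right)U^*:V\in\mathcal U,\ U\in\mathcal U_\Delta\right\}.$$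
   Context: $n$ is a positive integer, $\mathcal M$ is the algebra of complex $n\times n$ matrices, $\mathcal U$ the set of unitary matrices in $\mathcal M$, $\mathcal M^{\geq}$ the cone of non-negative Hermitian matrices in $\mathcal M$. Singular values of $A\in\mathcal M$ are ordered decreasingly: $\sigma_1(A)\geq\ldots\geq\sigma_n(A)$. $\mathcal S_{\mathbf t}=\{A\in\mathcal M:\prod_{j=1}^n\sigma_j(A)^{t_j}=1\}$. $\mathcal U_\Delta$ is the set of all $U\in\mathcal U$ with $\Delta=U\,\mathrm{diag}(\lambda_n,\ldots,\lambda_1)\,U^*$. For a non-empty $\mathcal A\subseteq\mathcal M$, $\iota(\Delta;\mathcal A)=\inf\{\mathrm{tr}(A\Delta A^* ):A\in\mathcal A\}$; it is written $m(\Delta;\mathcal A)$ when the infimum is attained (an assertion $m(\Delta;\mathcal A)=c$ includes that it is attained), and $\mathcal A(\Delta)$ denotes the set of all $A\in\mathcal A$ at which it is attained. *)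

theory Defs
  imports "HOL-Computational_Algebra.Fundamental_Theorem_Algebra" "Jordan_Normal_Form.Schur_Decomposition"
begin

definition mat_trace :: "complex mat \<Rightarrow> complex" where
  "mat_trace A = (\<Sum>i<dim_row A. A $$ (i, i))"

definition hermitian_mats :: "nat \<Rightarrow> complex mat set" where
  "hermitian_mats n = {A \<in> carrier_mat n n. mat_adjoint A = A}"

definition nonneg_mats :: "nat \<Rightarrow> complex mat set" where
  "nonneg_mats n = {A \<in> hermitian_mats n. \<forall>v \<in> carrier_vec n. 0 \<le> Re ((A *\<^sub>v v) \<bullet>c v)}"

definition unitary_mats :: "nat \<Rightarrow> complex mat set" where
  "unitary_mats n =
    {U \<in> carrier_mat n n. U * mat_adjoint U = 1\<^sub>m n \<and> mat_adjoint U * U = 1\<^sub>m n}"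

text \<open>For \<open>1 \<le> j \<le> n\<close>, the \<open>j\<close>-th largest eigenvalue, counted with multiplicity, of a
  Hermitian \<open>n\<close>-by-\<open>n\<close> matrix. It is meant for Hermitian arguments only, so that
  \<open>Re\<close> merely casts the (real) eigenvalues to type \<open>real\<close>; see \<open>char_poly_eigval\<close> below.\<close>

definition eigval :: "complex mat \<Rightarrow> nat \<Rightarrow> real" where
  "eigval A j = rev (sorted_list_of_multiset (image_mset Re (proots (char_poly A)))) ! (j - 1)"

definition sing_val :: "complex mat \<Rightarrow> nat \<Rightarrow> real" where
  "sing_val A j = sqrt (eigval (mat_adjoint A * A) j)"

definition S_mats :: "nat \<Rightarrow> (nat \<Rightarrow> real) \<Rightarrow> complex mat set" where
  "S_mats n t = {A \<in> carrier_mat n n. (\<Prod>j=1..n. sing_val A j powr t j) = 1}"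

text \<open>Rows and columns are numbered from \<open>0\<close>, so the diagonal entry in position \<open>i\<close> is
  \<open>\<lambda>\<^bsub>n-i\<^esub>\<close> and the diagonal reads \<open>\<lambda>\<^sub>n, \<dots>, \<lambda>\<^sub>1\<close>.\<close>

definition diagonalizers :: "nat \<Rightarrow> complex mat \<Rightarrow> complex mat set" where
  "diagonalizers n \<Delta> = {U \<in> unitary_mats n.
     \<Delta> = U * mat_diag n (\<lambda>i. complex_of_real (eigval \<Delta> (n - i))) * mat_adjoint U}"

text \<open>The trace of \<open>A \<Delta> A\<^sup>*\<close> is real when \<open>\<Delta>\<close> is Hermitian.\<close>

definition cost :: "complex mat \<Rightarrow> complex mat \<Rightarrow> real" where
  "cost \<Delta> A = Re (mat_trace (A * \<Delta> * mat_adjoint A))"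

definition iota :: "complex mat \<Rightarrow> complex mat set \<Rightarrow> real" where
  "iota \<Delta> \<A> = (INF A\<in>\<A>. cost \<Delta> A)"

definition minimizers :: "complex mat \<Rightarrow> complex mat set \<Rightarrow> complex mat set" where
  "minimizers \<Delta> \<A> = {A \<in> \<A>. cost \<Delta> A = iota \<Delta> \<A>}"

definition attained :: "complex mat \<Rightarrow> complex mat set \<Rightarrow> bool" where
  "attained \<Delta> \<A> \<longleftrightarrow> minimizers \<Delta> \<A> \<noteq> {}"

lemma mat_adjoint_index:
  "i < dim_col A \<Longrightarrow> j < dim_row A \<Longrightarrow> mat_adjoint A $$ (i, j) = conjugate (A $$ (j, i))"
  by (simp add: mat_adjoint_def mat_of_rows_index)

lemma hermitian_cscalar_prod:
  assumes A: "A \<in> hermitian_mats n" and v: "v \<in> carrier_vec n" and w: "w \<in> carrier_vec n"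
  shows "(A *\<^sub>v v) \<bullet>c w = v \<bullet>c (A *\<^sub>v w)"
proof -
  have dim: "dim_row A = n" "dim_col A = n" "mat_adjoint A = A"
    using A by (auto simp: hermitian_mats_def)
  have sym: "A $$ (i, j) = cnj (A $$ (j, i))" if "i < n" "j < n" for i j
    using mat_adjoint_index[of i A j] that dim by simp
  have "(A *\<^sub>v v) \<bullet>c w = (\<Sum>i<n. \<Sum>j<n. A $$ (i, j) * v $ j * cnj (w $ i))"
    using v w dim by (simp add: scalar_prod_def atLeast0LessThan sum_distrib_right)
  also have "\<dots> = (\<Sum>j<n. \<Sum>i<n. A $$ (i, j) * v $ j * cnj (w $ i))"
    by (rule sum.swap)
  also have "\<dots> = (\<Sum>j<n. \<Sum>i<n. v $ j * (cnj (A $$ (j, i)) * cnj (w $ i)))"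
  proof (intro sum.cong refl)
    fix j i assume "j \<in> {..<n}" "i \<in> {..<n}"
    hence "A $$ (i, j) = cnj (A $$ (j, i))" by (intro sym) auto
    thus "A $$ (i, j) * v $ j * cnj (w $ i) = v $ j * (cnj (A $$ (j, i)) * cnj (w $ i))"
      by (simp only: mult_ac)
  qed
  also have "\<dots> = v \<bullet>c (A *\<^sub>v w)"
    using v w dim by (simp add: scalar_prod_def atLeast0LessThan sum_distrib_left cnj_sum)
  finally show ?thesis .
qed

lemma hermitian_eigenvalue_real:
  assumes A: "A \<in> hermitian_mats n" and k: "eigenvalue A k"
  shows "k \<in> \<real>"
proof -
  have dim: "dim_row A = n" using A by (auto simp: hermitian_mats_def)
  obtain v where v: "v \<in> carrier_vec n" "v \<noteq> 0\<^sub>v n" "A *\<^sub>v v = k \<cdot>\<^sub>v v"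
    using k dim by (auto simp: eigenvalue_def eigenvector_def)
  have "k * (v \<bullet>c v) = cnj k * (v \<bullet>c v)"
    using hermitian_cscalar_prod[OF A v(1) v(1)] v(1)
    by (simp add: v(3) scalar_prod_def sum_distrib_left mult_ac)
  moreover have "v \<bullet>c v \<noteq> 0" using v by (simp add: conjugate_square_eq_0_vec)
  ultimately have "cnj k = k" by (metis mult_cancel_right)
  thus ?thesis by (simp only: Reals_cnj_iff)
qed

lemma length_eigvals:
  assumes "A \<in> carrier_mat n n"
  shows "length (sorted_list_of_multiset (image_mset Re (proots (char_poly A)))) = n"
proof -
  have "length (sorted_list_of_multiset (image_mset Re (proots (char_poly A)))) =
      size (image_mset Re (proots (char_poly A)))"
    by (metis mset_sorted_list_of_multiset size_mset)
  also have "\<dots> = n"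
    using degree_monic_char_poly[OF assms] by (simp add: size_proots_complex)
  finally show ?thesis .
qed

lemma char_poly_eigval:
  assumes A: "A \<in> hermitian_mats n"
  shows "char_poly A = (\<Prod>j=1..n. [:- complex_of_real (eigval A j), 1:])"
proof -
  have C: "A \<in> carrier_mat n n" using A by (simp add: hermitian_mats_def)
  define xs where "xs = rev (sorted_list_of_multiset (image_mset Re (proots (char_poly A))))"
  have len: "length xs = n" using length_eigvals[OF C] by (simp add: xs_def)
  have mon: "lead_coeff (char_poly A) = 1" using degree_monic_char_poly[OF C] by simp
  hence nz: "char_poly A \<noteq> 0" by auto
  have re: "complex_of_real (Re k) = k" if "k \<in># proots (char_poly A)" for k
    using that nz eigenvalue_root_char_poly[OF C, of k] hermitian_eigenvalue_real[OF A, of k]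
    by auto
  have "proots (char_poly A) = image_mset complex_of_real (image_mset Re (proots (char_poly A)))"
    using re by (simp add: multiset.map_comp o_def cong: image_mset_cong)
  also have "\<dots> = image_mset complex_of_real (mset xs)"
    by (simp add: xs_def)
  finally have pr: "proots (char_poly A) = image_mset complex_of_real (mset xs)" .
  have "char_poly A = (\<Prod>x\<in>#proots (char_poly A). [:- x, 1:])"
    using complex_poly_decompose_multiset[of "char_poly A"] mon by simp
  also have "\<dots> = prod_list (map (\<lambda>x. [:- complex_of_real x, 1:]) xs)"
    by (simp add: pr multiset.map_comp o_def flip: mset_map prod_mset_prod_list)
  also have "\<dots> = (\<Prod>i<n. [:- complex_of_real (xs ! i), 1:])"
    by (simp add: prod.list_conv_set_nth len atLeast0LessThan)
  also have "\<dots> = (\<Prod>j=1..n. [:- complex_of_real (eigval A j), 1:])"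
    by (rule prod.reindex_bij_witness[of _ "\<lambda>j. j - 1" Suc]) (auto simp: eigval_def xs_def)
  finally show ?thesis .
qed

lemma eigval_antimono:
  assumes A: "A \<in> carrier_mat n n" and ij: "1 \<le> i" "i \<le> j" "j \<le> n"
  shows "eigval A j \<le> eigval A i"
proof -
  let ?ys = "sorted_list_of_multiset (image_mset Re (proots (char_poly A)))"
  have "length ?ys = n" by (rule length_eigvals[OF A])
  moreover from this have "eigval A j = ?ys ! (n - j)" "eigval A i = ?ys ! (n - i)"
    using ij by (auto simp: eigval_def rev_nth)
  ultimately show ?thesis
    using ij sorted_nth_mono[of ?ys "n - j" "n - i"] by simp
qed

end

theory Submission
  imports Defs
begin

text \<open>
  Let \<open>A\<^sup>*A = W diag(g) W\<^sup>*\<close> with \<open>g\<close> decreasing and \<open>\<Delta> = U diag(d) U\<^sup>*\<close> with \<open>d\<close> increasing. Then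
  \<open>tr(A \<Delta> A\<^sup>*) = \<Sum>\<^sub>i\<^sub>j p\<^sub>i\<^sub>j g\<^sub>i d\<^sub>j\<close>, where \<open>p\<^sub>i\<^sub>j\<close> is the squared modulus of the entry \<open>(i, j)\<close> of the unitary
  matrix \<open>Q = W\<^sup>*U\<close>, so that \<open>p\<close> is doubly stochastic (\<open>cost_conj_diag\<close>). The constraint on \<open>A\<close>
  becomes \<open>\<Sum>\<^sub>i t\<^sub>i ln g\<^sub>i = 0\<close> with all \<open>g\<^sub>i\<close> positive (\<open>S_mats_iff\<close>).

  For invertible \<open>\<Delta>\<close> and decreasing \<open>t\<close>, a single logarithmic inequality replaces the combination of a
  trace inequality with the weighted inequality of arithmetic and geometric means. From
  \<open>1 + ln x \<le> x\<close> at \<open>x = g\<^sub>i d\<^sub>j / (c t\<^sub>i)\<close> one gets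
  \<open>g\<^sub>i d\<^sub>j \<ge> c t\<^sub>i (1 + ln g\<^sub>i + ln d\<^sub>j - ln c - ln t\<^sub>i)\<close>. Averaged with the weights \<open>p\<^sub>i\<^sub>j\<close>, the right-hand
  side is at least \<open>c \<Sum>\<^sub>i t\<^sub>i\<close> by the constraint, the choice of \<open>c\<close> and the rearrangement inequality
  for doubly stochastic weights (\<open>sum_minorant\<close>, \<open>rearrangement_doubly_stochastic\<close>).

  This route makes the case of equality transparent. It holds only if \<open>d\<^sub>j = c t\<^sub>i / g\<^sub>i\<close> whenever
  \<open>Q\<^sub>i\<^sub>j\<close> is nonzero (\<open>equality_support\<close>), which says that the columns of \<open>W\<close> are eigenvectors of
  \<open>\<Delta>\<close> with eigenvalues \<open>c t\<^sub>i / g\<^sub>i\<close>. An exchange argument shows that these are increasing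
  (\<open>equality_sorted\<close>), so \<open>W\<close> diagonalises \<open>\<Delta>\<close> in the prescribed order and \<open>g\<^sub>i = c t\<^sub>i / d\<^sub>i\<close>. The
  remaining unitary factor of \<open>A\<close> is free (\<open>svd_of_gram\<close>).

  For singular \<open>\<Delta>\<close> the first eigenvalue \<open>d\<^sub>0\<close> is zero. A large singular value in that direction
  costs nothing and lets all the others be arbitrarily small, so the infimum is zero; as the
  competitors are injective, it is attained only for \<open>\<Delta> = 0\<close>.
\<close>

section \<open>Adjoints, diagonal matrices and unitary matrices\<close>

lemma mat_adjoint_dim [simp]:
  "dim_row (mat_adjoint A) = dim_col A" "dim_col (mat_adjoint A) = dim_row A"
  by (simp_all add: mat_adjoint_def)

lemma mat_adjoint_carrier [simp]: "A \<in> carrier_mat m n \<Longrightarrow> mat_adjoint A \<in> carrier_mat n m"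
  by (intro carrier_matI) auto

lemma mat_adjoint_nth [simp]:
  fixes A :: "complex mat"
  shows "i < dim_col A \<Longrightarrow> j < dim_row A \<Longrightarrow> mat_adjoint A $$ (i, j) = cnj (A $$ (j, i))"
  by (simp add: mat_adjoint_index)

lemma mat_adjoint_adjoint [simp]: "mat_adjoint (mat_adjoint A) = (A :: complex mat)"
  by (rule eq_matI) auto

lemma mat_adjoint_mult:
  fixes A B :: "complex mat"
  assumes "A \<in> carrier_mat m k" "B \<in> carrier_mat k n"
  shows "mat_adjoint (A * B) = mat_adjoint B * mat_adjoint A"
  using assms by (intro eq_matI) (auto simp: scalar_prod_def cnj_sum mult.commute)

lemma mat_adjoint_diag_real:
  "mat_adjoint (mat_diag n (\<lambda>i. complex_of_real (f i))) = mat_diag n (\<lambda>i. complex_of_real (f i))"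
  by (rule eq_matI) (auto simp: mat_diag_def)

lemma mat_diag_cong: "(\<And>i. i < n \<Longrightarrow> f i = g i) \<Longrightarrow> mat_diag n f = mat_diag n g"
  by (rule eq_matI) (auto simp: mat_diag_def)

lemma mat_diag_dims [simp]: "dim_row (mat_diag n f) = n" "dim_col (mat_diag n f) = n"
  by (simp_all add: mat_diag_def)

text \<open>With all dimensions fixed to \<open>n\<close>, these become rewrite rules without extra variables,
  so that products of square matrices are re-associated by simplification alone.\<close>

lemmas square_simps =
  assoc_mult_mat[where n\<^sub>1 = n and n\<^sub>2 = n and n\<^sub>3 = n and n\<^sub>4 = n]
  mult_carrier_mat[where nr = n and n = n and nc = n]
  mat_adjoint_carrier[where m = n and n = n] for n

lemma unitaryD:
  assumes "U \<in> unitary_mats n"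
  shows "U \<in> carrier_mat n n" "mat_adjoint U \<in> carrier_mat n n"
    "U * mat_adjoint U = 1\<^sub>m n" "mat_adjoint U * U = 1\<^sub>m n"
  using assms by (auto simp: unitary_mats_def)

lemma unitaryI:
  assumes "U \<in> carrier_mat n n" "mat_adjoint U * U = 1\<^sub>m n"
  shows "U \<in> unitary_mats n"
  using assms mat_mult_left_right_inverse[of "mat_adjoint U" n U] by (simp add: unitary_mats_def)

lemma unitary_one: "1\<^sub>m n \<in> unitary_mats n"
proof -
  have "mat_adjoint (1\<^sub>m n) = (1\<^sub>m n :: complex mat)"
    by (rule eq_matI) auto
  thus ?thesis by (simp add: unitary_mats_def)
qed

lemma unitary_adjoint: "U \<in> unitary_mats n \<Longrightarrow> mat_adjoint U \<in> unitary_mats n"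
  by (auto simp: unitary_mats_def)

lemma unitary_cancel:
  assumes U: "U \<in> unitary_mats n" and B: "B \<in> carrier_mat n m"
  shows "mat_adjoint U * (U * B) = B" "U * (mat_adjoint U * B) = B"
proof -
  note * = unitaryD[OF U]
  have "mat_adjoint U * (U * B) = (mat_adjoint U * U) * B"
    by (rule assoc_mult_mat[symmetric, OF *(2) *(1) B])
  thus "mat_adjoint U * (U * B) = B" using * B by simp
  have "U * (mat_adjoint U * B) = (U * mat_adjoint U) * B"
    by (rule assoc_mult_mat[symmetric, OF *(1) *(2) B])
  thus "U * (mat_adjoint U * B) = B" using * B by simp
qed

lemma unitary_mult:
  assumes U: "U \<in> unitary_mats n" and V: "V \<in> unitary_mats n"
  shows "U * V \<in> unitary_mats n"
proof (rule unitaryI)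
  note * = unitaryD[OF U] unitaryD[OF V]
  show "U * V \<in> carrier_mat n n" using * by simp
  have "mat_adjoint (U * V) * (U * V) = mat_adjoint V * (mat_adjoint U * (U * V))"
    using * by (simp add: mat_adjoint_mult[of U n n V n] square_simps[where n=n])
  thus "mat_adjoint (U * V) * (U * V) = 1\<^sub>m n"
    using * unitary_cancel[OF U] by simp
qed

text \<open>A nonzero vector is completed to a basis, orthogonalised by Gram-Schmidt (which keeps the
  first vector), and the resulting columns are then normalised.\<close>

lemma unitary_first_column:
  fixes v :: "complex vec"
  assumes v: "v \<in> carrier_vec n" "v \<noteq> 0\<^sub>v n"
  obtains U c where "U \<in> unitary_mats n" "col U 0 = c \<cdot>\<^sub>v v"
proof -
  interpret cof_vec_space n "TYPE(complex)" .
  have n: "0 < n" using v by (cases n) auto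
  define b where "b = basis_completion v"
  define ws where "ws = gram_schmidt n b"
  from basis_completion[OF v, folded b_def]
  have dist_b: "distinct b" and indep: "\<not> lin_dep (set b)" and b: "set b \<subseteq> carrier_vec n"
    and hdb: "hd b = v" and len_b: "length b = n" by auto
  from hdb len_b n obtain vs where bv: "b = v # vs" by (cases b) auto
  from gram_schmidt_result[OF b dist_b indep refl, folded ws_def]
  have ws: "set ws \<subseteq> carrier_vec n" "corthogonal ws" "length ws = n" by (auto simp: len_b)
  have hdws: "hd ws = v" using gram_schmidt_hd[OF v(1), of vs] by (simp add: ws_def bv)
  have ws_nth: "ws ! i \<in> carrier_vec n" if "i < n" for i using ws that by auto
  define s where "s i = Re (ws ! i \<bullet>c ws ! i)" for i
  have s: "ws ! i \<bullet>c ws ! i = complex_of_real (s i) \<and> 0 < s i" if i: "i < n" for i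
  proof -
    define r where "r = (\<Sum>k<n. (cmod (ws ! i $ k))\<^sup>2)"
    have "ws ! i \<bullet>c ws ! i = complex_of_real r"
      using ws_nth[OF i] unfolding r_def of_real_sum
      by (simp add: scalar_prod_def atLeast0LessThan complex_norm_square del: of_real_power)
    moreover have "0 \<le> r" by (simp add: r_def sum_nonneg)
    moreover have "ws ! i \<bullet>c ws ! i \<noteq> 0" using corthogonalD[OF ws(2)] i ws(3) by auto
    ultimately show ?thesis by (simp add: s_def less_le)
  qed
  define U where "U = Matrix.mat n n (\<lambda>(k, i). ws ! i $ k / complex_of_real (sqrt (s i)))"
  have "U \<in> unitary_mats n"
  proof (rule unitaryI)
    show U: "U \<in> carrier_mat n n" by (simp add: U_def)
    show "mat_adjoint U * U = 1\<^sub>m n"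
    proof (rule eq_matI)
      fix i j assume "i < dim_row (1\<^sub>m n :: complex mat)" "j < dim_col (1\<^sub>m n :: complex mat)"
      hence ij: "i < n" "j < n" by auto
      have "(mat_adjoint U * U) $$ (i, j)
          = (\<Sum>k<n. cnj (U $$ (k, i)) * U $$ (k, j))"
        using U ij by (simp add: scalar_prod_def atLeast0LessThan)
      also have "\<dots> = (\<Sum>k<n. ws ! j $ k * cnj (ws ! i $ k)) / (sqrt (s i) * sqrt (s j))"
        using ij by (simp add: U_def sum_divide_distrib mult.commute)
      also have "(\<Sum>k<n. ws ! j $ k * cnj (ws ! i $ k)) = ws ! j \<bullet>c ws ! i"
        using ws_nth[OF ij(1)] ws_nth[OF ij(2)] by (simp add: scalar_prod_def atLeast0LessThan)
      also have "\<dots> = (if i = j then s i else 0)"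
        using corthogonalD[OF ws(2), of j i] s ij ws(3) by auto
      finally show "(mat_adjoint U * U) $$ (i, j) = 1\<^sub>m n $$ (i, j)"
        using s[of i] ij by (auto simp flip: of_real_mult)
    qed (use U in auto)
  qed
  moreover have "col U 0 = (1 / complex_of_real (sqrt (s 0))) \<cdot>\<^sub>v v"
  proof -
    have "ws \<noteq> []" using ws(3) n by auto
    hence "ws ! 0 = v" using hdws by (simp add: hd_conv_nth)
    thus ?thesis using n v(1) by (intro eq_vecI) (auto simp: U_def)
  qed
  ultimately show ?thesis by (rule that)
qed

section \<open>Unitary conjugates of real diagonal matrices and their eigenvalues\<close>

definition conj_diag :: "nat \<Rightarrow> complex mat \<Rightarrow> (nat \<Rightarrow> real) \<Rightarrow> complex mat" where
  "conj_diag n U f = U * mat_diag n (\<lambda>i. complex_of_real (f i)) * mat_adjoint U"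

lemma conj_diag_carrier [simp]: "U \<in> unitary_mats n \<Longrightarrow> conj_diag n U f \<in> carrier_mat n n"
  using unitaryD[of U n] by (auto simp: conj_diag_def)

lemma conj_diag_cong: "(\<And>i. i < n \<Longrightarrow> f i = g i) \<Longrightarrow> conj_diag n U f = conj_diag n U g"
  unfolding conj_diag_def by (metis (mono_tags, lifting) mat_diag_cong)

lemma conj_diag_similar:
  assumes "U \<in> unitary_mats n"
  shows "similar_mat (conj_diag n U f) (mat_diag n (\<lambda>i. complex_of_real (f i)))"
  using unitaryD[OF assms] conj_diag_carrier[OF assms, of f]
  by (intro similar_matI[of _ _ U "mat_adjoint U" n]) (auto simp: conj_diag_def)

lemma char_poly_mat_diag: "char_poly (mat_diag n f) = (\<Prod>i<n. [:- f i :: complex, 1:])"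
proof -
  have "char_poly (mat_diag n f) = (\<Prod>a\<leftarrow>diag_mat (mat_diag n f). [:- a, 1:])"
    by (rule char_poly_upper_triangular[of _ n]) (auto simp: mat_diag_def upper_triangular_def)
  also have "diag_mat (mat_diag n f) = map f [0..<n]"
    by (auto simp: diag_mat_def mat_diag_def)
  finally show ?thesis by (simp add: prod.list_conv_set_nth atLeast0LessThan)
qed

lemma char_poly_conj_diag:
  "U \<in> unitary_mats n \<Longrightarrow> char_poly (conj_diag n U f) = (\<Prod>i<n. [:- complex_of_real (f i), 1:])"
  by (simp add: char_poly_similar[OF conj_diag_similar] char_poly_mat_diag)

text \<open>The real roots of a split characteristic polynomial, listed decreasingly, are the eigenvalues
  in the required order, because sorting a multiset has a unique outcome.\<close>

lemma eigval_of_char_poly: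
  assumes cp: "char_poly A = (\<Prod>i<n. [:- complex_of_real (f i), 1:])"
    and f: "\<And>i j. i \<le> j \<Longrightarrow> j < n \<Longrightarrow> f j \<le> f i" and i: "i < n"
  shows "eigval A (Suc i) = f i"
proof -
  have lin: "proots [:- complex_of_real x, 1:] = {#complex_of_real x#}" for x
    using proots_linear_factor[of "complex_of_real x"] by simp
  have "proots (char_poly A) = (\<Sum>i<n. {#complex_of_real (f i)#})"
    unfolding cp by (subst proots_prod) (auto simp: lin)
  moreover have "image_mset Re (\<Sum>i<m. {#complex_of_real (f i)#}) = mset (map f [0..<m])" for m
    by (induct m) auto
  ultimately have "image_mset Re (proots (char_poly A)) = mset (map f [0..<n])"
    by simp
  also have "\<dots> = mset (rev (map f [0..<n]))" by simp
  finally have "sorted_list_of_multiset (image_mset Re (proots (char_poly A)))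
      = sort (rev (map f [0..<n]))"
    by (simp only: sorted_list_of_multiset_mset)
  also have "\<dots> = rev (map f [0..<n])"
    using f by (intro sorted_sort_id) (auto simp: sorted_iff_nth_mono rev_nth)
  finally show ?thesis using i by (simp add: eigval_def)
qed

section \<open>The spectral theorem for Hermitian matrices\<close>

text \<open>Direct sum of a scalar and a matrix; the inductive step of the spectral theorem splits off
  one eigenvector at a time, and the direct sum is compatible with all operations involved.\<close>

definition one_block :: "complex \<Rightarrow> complex mat \<Rightarrow> complex mat" where
  "one_block x M = four_block_mat (mat_diag 1 (\<lambda>_. x)) (0\<^sub>m 1 (dim_row M)) (0\<^sub>m (dim_row M) 1) M"

lemma one_block_carrier [simp]: "M \<in> carrier_mat n n \<Longrightarrow> one_block x M \<in> carrier_mat (Suc n) (Suc n)"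
  using four_block_carrier_mat[of "mat_diag 1 (\<lambda>_. x)" 1 1 M n n] by (simp add: one_block_def)

lemma one_block_mult:
  assumes "M \<in> carrier_mat n n" "N \<in> carrier_mat n n"
  shows "one_block x M * one_block y N = one_block (x * y) (M * N)"
  unfolding one_block_def using assms
  by (subst mult_four_block_mat[of _ 1 1 _ n _ n _ _ 1 _ n]) auto

lemma one_block_adjoint:
  assumes "M \<in> carrier_mat n n"
  shows "mat_adjoint (one_block x M) = one_block (cnj x) (mat_adjoint M)"
  using assms one_block_carrier[OF assms, of x] one_block_carrier[of "mat_adjoint M" n "cnj x"]
  by (intro eq_matI) (auto simp: one_block_def mat_diag_def)

lemma one_block_diag: "one_block (f 0) (mat_diag n (\<lambda>i. f (Suc i))) = mat_diag (Suc n) f"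
  by (rule eq_matI) (auto simp: one_block_def mat_diag_def)

lemma unitary_one_block:
  assumes "U \<in> unitary_mats n"
  shows "one_block 1 U \<in> unitary_mats (Suc n)"
proof (rule unitaryI)
  note * = unitaryD[OF assms]
  show "one_block 1 U \<in> carrier_mat (Suc n) (Suc n)" using * by simp
  have "mat_adjoint (one_block 1 U) * one_block 1 U = one_block 1 (1\<^sub>m n)"
    using * by (simp add: one_block_adjoint[of U n] one_block_mult[of _ n])
  also have "\<dots> = 1\<^sub>m (Suc n)"
    using one_block_diag[of "\<lambda>_. 1" n] by simp
  finally show "mat_adjoint (one_block 1 U) * one_block 1 U = 1\<^sub>m (Suc n)" .
qed

lemma char_poly_one_block:
  assumes "M \<in> carrier_mat n n"
  shows "char_poly (one_block x M) = [:- x, 1:] * char_poly M"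
  using assms char_poly_four_block_zeros_col[of "mat_diag 1 (\<lambda>_. x)" "0\<^sub>m 1 n" n M]
    char_poly_mat_diag[of 1 "\<lambda>_. x"]
  by (simp add: one_block_def)

lemma conj_diag_unitary_conj:
  assumes W: "W \<in> unitary_mats n" and U: "U \<in> unitary_mats n"
  shows "W * conj_diag n U f * mat_adjoint W = conj_diag n (W * U) f"
proof -
  note * = unitaryD[OF W] unitaryD[OF U]
  show ?thesis
    using * by (simp add: conj_diag_def mat_adjoint_mult[of W n n U n] square_simps[where n=n])
qed

lemma unitary_conj_swap:
  assumes W: "W \<in> unitary_mats n" and A: "A \<in> carrier_mat n n"
    and B: "B = mat_adjoint W * A * W"
  shows "A = W * B * mat_adjoint W"
proof -
  note * = unitaryD[OF W]
  have "W * B * mat_adjoint W = W * (mat_adjoint W * (A * (W * mat_adjoint W)))"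
    unfolding B using * A by (simp add: square_simps[where n=n])
  also have "\<dots> = A"
    using * A unitary_cancel(2)[OF W, of A n] by simp
  finally show ?thesis by simp
qed

lemma hermitian_unitary_conj:
  assumes A: "A \<in> hermitian_mats n" and W: "W \<in> unitary_mats n"
  shows "mat_adjoint W * A * W \<in> hermitian_mats n"
proof -
  note * = unitaryD[OF W]
  have "A \<in> carrier_mat n n" "mat_adjoint A = A" using A by (auto simp: hermitian_mats_def)
  thus ?thesis using *
    by (simp add: hermitian_mats_def mat_adjoint_mult[of _ n n _ n] square_simps[where n=n])
qed

text \<open>Induction on the dimension. A unitary matrix \<open>W\<close> whose first column is an eigenvector for the
  first prescribed root conjugates \<open>A\<close> into a matrix whose first column is a multiple of the first
  unit vector. Being Hermitian, that matrix is a direct sum of the eigenvalue and a smaller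
  Hermitian matrix, whose characteristic polynomial is the remaining product. Prescribing the
  roots as a sequence lets the eigenvalues appear on the diagonal in any desired order.\<close>

lemma hermitian_spectral:
  assumes "A \<in> hermitian_mats n"
    and "char_poly A = (\<Prod>i<n. [:- complex_of_real (f i), 1:])"
  shows "\<exists>U \<in> unitary_mats n. A = conj_diag n U f"
  using assms
proof (induction n arbitrary: A f)
  case 0
  hence "A = conj_diag 0 (1\<^sub>m 0) f"
    using conj_diag_carrier[OF unitary_one[of 0], of f] by (intro eq_matI) (auto simp: hermitian_mats_def)
  thus ?case using unitary_one[of 0] by blast
next
  case (Suc n)
  let ?N = "Suc n" and ?e = "complex_of_real (f 0)"
  have A: "A \<in> carrier_mat ?N ?N" using Suc.prems by (simp add: hermitian_mats_def)
  have cp: "char_poly A = [:- ?e, 1:] * (\<Prod>i<n. [:- complex_of_real (f (Suc i)), 1:])"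
    by (simp add: Suc.prems(2) prod.lessThan_Suc_shift del: prod.lessThan_Suc)
  hence "eigenvalue A ?e" by (simp add: eigenvalue_root_char_poly[OF A])
  then obtain v where v: "v \<in> carrier_vec ?N" "v \<noteq> 0\<^sub>v ?N" "A *\<^sub>v v = ?e \<cdot>\<^sub>v v"
    using A by (auto simp: eigenvalue_def eigenvector_def)
  obtain W c where W: "W \<in> unitary_mats ?N" and col: "col W 0 = c \<cdot>\<^sub>v v"
    by (rule unitary_first_column[OF v(1,2)])
  note W' = unitaryD[OF W]
  define B where "B = mat_adjoint W * A * W"
  have B: "B \<in> carrier_mat ?N ?N" "mat_adjoint B = B"
    using hermitian_unitary_conj[OF Suc.prems(1) W] by (auto simp: B_def hermitian_mats_def)
  have AW: "A * W \<in> carrier_mat ?N ?N" using A W' by simp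
  have "col (A * W) 0 = A *\<^sub>v col W 0"
    by (rule col_mult2[OF A W'(1)]) simp
  also have "\<dots> = c \<cdot>\<^sub>v (A *\<^sub>v v)"
    unfolding col by (rule mult_mat_vec[OF A v(1)])
  also have "\<dots> = ?e \<cdot>\<^sub>v col W 0"
    unfolding v(3) col by (simp add: smult_smult_assoc mult.commute)
  finally have colAW: "col (A * W) 0 = ?e \<cdot>\<^sub>v col W 0" .
  have first: "B $$ (i, 0) = (if i = 0 then ?e else 0)" if i: "i < ?N" for i
  proof -
    have "B = mat_adjoint W * (A * W)"
      using A W' by (simp add: B_def square_simps[where n="?N"])
    hence "B $$ (i, 0) = row (mat_adjoint W) i \<bullet> col (A * W) 0"
      using i W' AW by simp
    also have "\<dots> = ?e * (row (mat_adjoint W) i \<bullet> col W 0)"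
      using W'(1,2) i by (simp add: colAW scalar_prod_smult_right)
    also have "row (mat_adjoint W) i \<bullet> col W 0 = (mat_adjoint W * W) $$ (i, 0)"
      using i W'(1,2) by simp
    also have "\<dots> = (if i = 0 then 1 else 0)"
      using i by (simp add: W'(4))
    finally show ?thesis by simp
  qed
  have first': "B $$ (0, i) = (if i = 0 then ?e else 0)" if i: "i < ?N" for i
    using mat_adjoint_nth[of 0 B i] first[OF i] i B by simp
  define M where "M = Matrix.mat n n (\<lambda>(i, j). B $$ (Suc i, Suc j))"
  have M: "M \<in> carrier_mat n n" by (simp add: M_def)
  have BM: "B = one_block ?e M"
    using B(1) one_block_carrier[OF M, of ?e] first first'
    by (intro eq_matI) (auto simp: one_block_def M_def mat_diag_def)
  have "mat_adjoint M = M"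
  proof (rule eq_matI)
    fix i j assume "i < dim_row M" "j < dim_col M"
    thus "mat_adjoint M $$ (i, j) = M $$ (i, j)"
      using mat_adjoint_nth[of "Suc i" B "Suc j"] B M by (simp add: M_def)
  qed (simp_all add: M_def)
  hence "M \<in> hermitian_mats n" using M by (simp add: hermitian_mats_def)
  moreover have "similar_mat B A"
    using A B W' by (intro similar_matI[of _ _ "mat_adjoint W" W ?N]) (auto simp: B_def)
  hence "[:- ?e, 1:] * char_poly M = [:- ?e, 1:] * (\<Prod>i<n. [:- complex_of_real (f (Suc i)), 1:])"
    using char_poly_similar[of B A] cp char_poly_one_block[OF M, of ?e] BM by simp
  hence "char_poly M = (\<Prod>i<n. [:- complex_of_real (f (Suc i)), 1:])"
    by (metis mult_cancel_left pCons_eq_0_iff zero_neq_one)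
  ultimately obtain U where U: "U \<in> unitary_mats n" "M = conj_diag n U (\<lambda>i. f (Suc i))"
    using Suc.IH[of M "\<lambda>i. f (Suc i)"] by auto
  note U' = unitaryD[OF U(1)]
  have "conj_diag ?N (one_block 1 U) f
      = one_block 1 U * one_block ?e (mat_diag n (\<lambda>i. complex_of_real (f (Suc i))))
        * mat_adjoint (one_block 1 U)"
    using one_block_diag[of "\<lambda>i. complex_of_real (f i)" n] by (simp add: conj_diag_def)
  also have "\<dots> = one_block ?e M"
    using U' by (simp add: one_block_adjoint[of U n] one_block_mult[of _ n] U(2) conj_diag_def)
  finally have "A = W * conj_diag ?N (one_block 1 U) f * mat_adjoint W"
    using unitary_conj_swap[OF W A B_def] by (simp add: BM)
  hence "A = conj_diag ?N (W * one_block 1 U) f"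
    by (simp add: conj_diag_unitary_conj[OF W unitary_one_block[OF U(1)]])
  thus ?case using unitary_mult[OF W unitary_one_block[OF U(1)]] by blast
qed

lemma eigval_conj_diag_antimono:
  assumes "U \<in> unitary_mats n" "\<And>i j. i \<le> j \<Longrightarrow> j < n \<Longrightarrow> f j \<le> f i" "i < n"
  shows "eigval (conj_diag n U f) (Suc i) = f i"
  by (rule eigval_of_char_poly[OF char_poly_conj_diag[OF assms(1)]]) (use assms in auto)

text \<open>Eigenvalues are numbered decreasingly, so an increasing diagonal is read backwards; the product
  defining the characteristic polynomial is insensitive to this reversal.\<close>

lemma eigval_conj_diag_mono:
  assumes U: "U \<in> unitary_mats n" and f: "\<And>i j. i \<le> j \<Longrightarrow> j < n \<Longrightarrow> f i \<le> f j" and i: "i < n"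
  shows "eigval (conj_diag n U f) (n - i) = f i"
proof -
  have "char_poly (conj_diag n U f) = (\<Prod>i<n. [:- complex_of_real (f (n - Suc i)), 1:])"
    unfolding char_poly_conj_diag[OF U] by (rule prod.nat_diff_reindex[symmetric])
  hence "eigval (conj_diag n U f) (Suc (n - Suc i)) = f (n - Suc (n - Suc i))"
    using f i by (intro eigval_of_char_poly) auto
  thus ?thesis using i by (simp add: Suc_diff_Suc)
qed

lemma hermitian_conj_diag_antimono:
  assumes A: "A \<in> hermitian_mats n"
  obtains U where "U \<in> unitary_mats n" "A = conj_diag n U (\<lambda>i. eigval A (Suc i))"
proof -
  have "char_poly A = (\<Prod>i<n. [:- complex_of_real (eigval A (Suc i)), 1:])"
    unfolding char_poly_eigval[OF A]
    by (rule prod.reindex_bij_witness[of _ Suc "\<lambda>j. j - 1"]) auto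
  from hermitian_spectral[OF A this] show ?thesis using that by blast
qed

lemma hermitian_diagonalizers:
  assumes A: "A \<in> hermitian_mats n"
  shows "diagonalizers n A \<noteq> {}"
proof -
  have "char_poly A = (\<Prod>i<n. [:- complex_of_real (eigval A (n - i)), 1:])"
    unfolding char_poly_eigval[OF A]
    by (rule prod.reindex_bij_witness[of _ "\<lambda>i. n - i" "\<lambda>j. n - j"]) auto
  thus ?thesis using hermitian_spectral[OF A] by (fastforce simp: diagonalizers_def conj_diag_def)
qed

section \<open>Positivity and invertibility in terms of the spectrum\<close>

text \<open>The diagonal entries are the values of the quadratic form at the columns of \<open>U\<close>.\<close>

lemma nonneg_conj_diag:
  assumes A: "conj_diag n U f \<in> nonneg_mats n" and U: "U \<in> unitary_mats n" and i: "i < n"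
  shows "0 \<le> f i"
proof -
  note * = unitaryD[OF U]
  let ?D = "mat_diag n (\<lambda>i. complex_of_real (f i))"
  have c: "col U i \<in> carrier_vec n" using * i by auto
  have AU: "conj_diag n U f * U = U * ?D"
    using * by (simp add: conj_diag_def square_simps[where n=n])
  have "conj_diag n U f *\<^sub>v col U i = col (conj_diag n U f * U) i"
    using * U i by (simp add: col_mult2[of _ n n _ n])
  also have "\<dots> = complex_of_real (f i) \<cdot>\<^sub>v col U i"
    unfolding AU using * i by (intro eq_vecI) (auto simp: mat_diag_mult_right[of _ n])
  finally have "(conj_diag n U f *\<^sub>v col U i) \<bullet>c col U i = f i * (col U i \<bullet>c col U i)"
    using c by simp
  also have "col U i \<bullet>c col U i = (mat_adjoint U * U) $$ (i, i)"
    using *(1) i by (simp add: scalar_prod_def mult.commute)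
  also have "\<dots> = 1" unfolding *(4) using i by simp
  finally show ?thesis using A c by (force simp: nonneg_mats_def)
qed

lemma diagonalizers_iff:
  "U \<in> diagonalizers n \<Delta> \<longleftrightarrow> U \<in> unitary_mats n \<and> \<Delta> = conj_diag n U (\<lambda>i. eigval \<Delta> (n - i))"
  by (simp add: diagonalizers_def conj_diag_def)

lemma eigval_ascending:
  assumes "\<Delta> \<in> carrier_mat n n" "i \<le> j" "j < n"
  shows "eigval \<Delta> (n - i) \<le> eigval \<Delta> (n - j)"
  using assms by (intro eigval_antimono) auto

lemma eigval_nonneg:
  assumes \<Delta>: "\<Delta> \<in> nonneg_mats n" and i: "i < n"
  shows "0 \<le> eigval \<Delta> (n - i)"
proof -
  obtain U where "U \<in> diagonalizers n \<Delta>"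
    using hermitian_diagonalizers[of \<Delta> n] \<Delta> by (auto simp: nonneg_mats_def)
  hence "U \<in> unitary_mats n" "\<Delta> = conj_diag n U (\<lambda>i. eigval \<Delta> (n - i))"
    by (simp_all add: diagonalizers_iff)
  thus ?thesis using nonneg_conj_diag[of n U "\<lambda>i. eigval \<Delta> (n - i)" i] \<Delta> i by simp
qed

lemma gram_nonneg:
  assumes A: "A \<in> carrier_mat n n"
  shows "mat_adjoint A * A \<in> nonneg_mats n"
proof -
  have herm: "mat_adjoint A * A \<in> hermitian_mats n"
    using A by (simp add: hermitian_mats_def mat_adjoint_mult[of _ n n _ n] square_simps[where n=n])
  have "0 \<le> Re ((mat_adjoint A * A *\<^sub>v v) \<bullet>c v)" if v: "v \<in> carrier_vec n" for v
  proof -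
    define w where "w = A *\<^sub>v v"
    have w: "w \<in> carrier_vec n" using A v by (simp add: w_def)
    have "(mat_adjoint A * A *\<^sub>v v) \<bullet>c v = (mat_adjoint A *\<^sub>v w) \<bullet>c v"
      using A v by (simp add: w_def assoc_mult_mat_vec[of _ n n _ n])
    also have "\<dots> = (\<Sum>i<n. \<Sum>j<n. cnj (A $$ (j, i)) * w $ j * cnj (v $ i))"
      using A v w by (simp add: scalar_prod_def atLeast0LessThan sum_distrib_right)
    also have "\<dots> = (\<Sum>j<n. w $ j * cnj (\<Sum>i<n. A $$ (j, i) * v $ i))"
      by (subst sum.swap) (simp add: sum_distrib_left cnj_sum mult_ac)
    also have "\<dots> = (\<Sum>j<n. w $ j * cnj (w $ j))"
      using A v by (simp add: w_def scalar_prod_def atLeast0LessThan)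
    finally show ?thesis by (simp add: Re_sum sum_nonneg)
  qed
  thus ?thesis using herm by (simp add: nonneg_mats_def)
qed

lemma invertible_conj_diag:
  assumes U: "U \<in> unitary_mats n"
  shows "invertible_mat (conj_diag n U f) \<longleftrightarrow> (\<forall>i<n. f i \<noteq> 0)"
proof
  note * = unitaryD[OF U]
  let ?D = "\<lambda>f. mat_diag n (\<lambda>i. complex_of_real (f i))"
  have mult: "conj_diag n U f * conj_diag n U g = conj_diag n U (\<lambda>i. f i * g i)" for f g
  proof -
    have "conj_diag n U f * conj_diag n U g
        = U * (?D f * (mat_adjoint U * (U * (?D g * mat_adjoint U))))"
      using * by (simp add: conj_diag_def square_simps[where n=n])
    also have "\<dots> = U * (?D f * (?D g * mat_adjoint U))"
      using * unitary_cancel(1)[OF U, of "?D g * mat_adjoint U" n]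
      by (simp add: square_simps[where n=n])
    also have "\<dots> = U * (?D f * ?D g * mat_adjoint U)"
      using * by (simp only: square_simps[where n=n] mat_diag_dim)
    finally show ?thesis
      using * by (simp add: conj_diag_def square_simps[where n=n])
  qed
  have dim: "conj_diag n U g \<in> carrier_mat n n" for g using U by simp
  {
    assume "\<forall>i<n. f i \<noteq> 0"
    hence "conj_diag n U (\<lambda>i. f i * inverse (f i)) = conj_diag n U (\<lambda>_. 1)"
          "conj_diag n U (\<lambda>i. inverse (f i) * f i) = conj_diag n U (\<lambda>_. 1)"
      by (auto intro!: conj_diag_cong)
    moreover have "conj_diag n U (\<lambda>_. 1) = 1\<^sub>m n"
      using * by (simp add: conj_diag_def)
    ultimately show "invertible_mat (conj_diag n U f)"
      using mult[of f "\<lambda>i. inverse (f i)"] mult[of "\<lambda>i. inverse (f i)" f] dim[of f]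
        dim[of "\<lambda>i. inverse (f i)"]
      by (auto simp: invertible_mat_def inverts_mat_def)
  next
    assume "invertible_mat (conj_diag n U f)"
    then obtain B where B': "conj_diag n U f * B = 1\<^sub>m n" "B * conj_diag n U f = 1\<^sub>m (dim_row B)"
      using dim[of f] by (auto simp: invertible_mat_def inverts_mat_def)
    have "dim_col B = n"
      by (metis B'(1) index_mult_mat(3) index_one_mat(3))
    moreover have "dim_row B = n"
      by (metis B'(2) dim[of f] carrier_matD(2) index_mult_mat(3) index_one_mat(3))
    ultimately have B: "conj_diag n U f * B = 1\<^sub>m n" "B \<in> carrier_mat n n"
      using B'(1) by auto
    have "?D f * (mat_adjoint U * (B * U)) = mat_adjoint U * (U * (?D f * (mat_adjoint U * (B * U))))"
      using * B unitary_cancel(1)[OF U, of "?D f * (mat_adjoint U * (B * U))" n]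
      by (simp add: square_simps[where n=n])
    also have "\<dots> = mat_adjoint U * (conj_diag n U f * B * U)"
      using * B(2) by (simp add: conj_diag_def square_simps[where n=n])
    also have "\<dots> = 1\<^sub>m n" using * B by simp
    finally have eq: "?D f * (mat_adjoint U * (B * U)) = 1\<^sub>m n" .
    show "\<forall>i<n. f i \<noteq> 0"
    proof (intro allI impI)
      fix i assume i: "i < n"
      have "mat_adjoint U * (B * U) \<in> carrier_mat n n"
        using * B by (simp add: square_simps[where n=n])
      hence "(?D f * (mat_adjoint U * (B * U))) $$ (i, i)
          = f i * (mat_adjoint U * (B * U)) $$ (i, i)"
        using i by (simp only: mat_diag_mult_left) simp
      thus "f i \<noteq> 0" using i unfolding eq by auto
    qed
  }
qed

section \<open>Doubly stochastic weights and the weighted logarithmic bound\<close>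

definition doubly_stochastic :: "nat \<Rightarrow> (nat \<Rightarrow> nat \<Rightarrow> real) \<Rightarrow> bool" where
  "doubly_stochastic n p \<longleftrightarrow> (\<forall>i<n. \<forall>j<n. 0 \<le> p i j)
     \<and> (\<forall>i<n. (\<Sum>j<n. p i j) = 1) \<and> (\<forall>j<n. (\<Sum>i<n. p i j) = 1)"

lemma doubly_stochasticD:
  assumes "doubly_stochastic n p"
  shows "\<And>i j. i < n \<Longrightarrow> j < n \<Longrightarrow> 0 \<le> p i j"
    "\<And>i. i < n \<Longrightarrow> (\<Sum>j<n. p i j) = 1" "\<And>j. j < n \<Longrightarrow> (\<Sum>i<n. p i j) = 1"
  using assms by (auto simp: doubly_stochastic_def)

lemma doubly_stochastic_sum_marginals:
  assumes p: "doubly_stochastic n p"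
  shows "(\<Sum>i<n. \<Sum>j<n. p i j * u i) = (\<Sum>i<n. u i)" "(\<Sum>i<n. \<Sum>j<n. p i j * v j) = (\<Sum>j<n. v j)"
proof -
  note * = doubly_stochasticD[OF p]
  show "(\<Sum>i<n. \<Sum>j<n. p i j * u i) = (\<Sum>i<n. u i)"
    by (intro sum.cong refl) (simp add: * flip: sum_distrib_right)
  have "(\<Sum>i<n. \<Sum>j<n. p i j * v j) = (\<Sum>j<n. \<Sum>i<n. p i j * v j)"
    by (rule sum.swap)
  also have "\<dots> = (\<Sum>j<n. v j)"
    by (intro sum.cong refl) (simp add: * flip: sum_distrib_right)
  finally show "(\<Sum>i<n. \<Sum>j<n. p i j * v j) = (\<Sum>j<n. v j)" .
qed

text \<open>Linear programming duality: potentials \<open>u\<close> and \<open>v\<close> with \<open>u i + v j \<le> t i * x j\<close>, and equality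
  on the diagonal, certify that the identity matrix is an optimal transport plan between the
  oppositely ordered sequences \<open>t\<close> and \<open>x\<close>. The potential \<open>u\<close> is the discrete integral of \<open>x\<close>
  with respect to \<open>t\<close>, and the inequality follows by comparing \<open>x\<close> on the interval between \<open>i\<close>
  and \<open>j\<close> with its value at the end point \<open>j\<close>.\<close>

lemma rearrangement_doubly_stochastic:
  fixes t x :: "nat \<Rightarrow> real"
  assumes p: "doubly_stochastic n p"
    and t: "\<And>i j. i \<le> j \<Longrightarrow> j < n \<Longrightarrow> t j \<le> t i"
    and x: "\<And>i j. i \<le> j \<Longrightarrow> j < n \<Longrightarrow> x i \<le> x j"
  shows "(\<Sum>i<n. t i * x i) \<le> (\<Sum>i<n. \<Sum>j<n. p i j * (t i * x j))"
proof -
  define u where "u i = (\<Sum>k<i. (t (Suc k) - t k) * x k)" for i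
  define v where "v j = t j * x j - u j" for j
  have le: "u i + v j \<le> t i * x j" if ij: "i < n" "j < n" for i j
  proof (cases "j \<le> i")
    case True
    hence "u i \<le> u j + (t i - t j) * x j" using ij(1)
    proof (induction i rule: dec_induct)
      case (step k)
      have "(t (Suc k) - t k) * x k \<le> (t (Suc k) - t k) * x j"
        using t[of k "Suc k"] x[of j k] step by (intro mult_left_mono_neg) auto
      thus ?case using step by (simp add: u_def algebra_simps)
    qed simp
    thus ?thesis by (simp add: v_def algebra_simps)
  next
    case False
    hence "i \<le> j" by simp
    hence "u i \<le> u j + (t i - t j) * x j"
    proof (induction i rule: inc_induct)
      case (step k)
      have "(t k - t (Suc k)) * x k \<le> (t k - t (Suc k)) * x j"
        using t[of k "Suc k"] x[of k j] step ij by (intro mult_left_mono) auto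
      thus ?case using step by (simp add: u_def algebra_simps)
    qed simp
    thus ?thesis by (simp add: v_def algebra_simps)
  qed
  have "(\<Sum>i<n. t i * x i) = (\<Sum>i<n. u i) + (\<Sum>j<n. v j)"
    by (simp add: v_def flip: sum.distrib)
  also have "\<dots> = (\<Sum>i<n. \<Sum>j<n. p i j * (u i + v j))"
    by (simp only: distrib_left sum.distrib doubly_stochastic_sum_marginals[OF p])
  also have "\<dots> \<le> (\<Sum>i<n. \<Sum>j<n. p i j * (t i * x j))"
    using doubly_stochasticD(1)[OF p] le by (intro sum_mono mult_left_mono) auto
  finally show ?thesis .
qed

text \<open>The setting of the scalar minimisation problem. Here \<open>d\<close> stands for the eigenvalues of the
  weight, \<open>g\<close> for the squared singular values of a competitor and \<open>p\<close> for the squared moduli of the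
  entries of the unitary matrix relating the two eigenbases. The constant \<open>c\<close> is the weighted
  geometric mean of the quotients \<open>d i / t i\<close>.\<close>

locale cost_data =
  fixes n :: nat and t d g :: "nat \<Rightarrow> real" and c :: real and p :: "nat \<Rightarrow> nat \<Rightarrow> real"
  assumes p: "doubly_stochastic n p"
    and t_pos: "\<And>i. i < n \<Longrightarrow> 0 < t i" and t: "\<And>i j. i \<le> j \<Longrightarrow> j < n \<Longrightarrow> t j \<le> t i"
    and d_pos: "\<And>i. i < n \<Longrightarrow> 0 < d i" and d: "\<And>i j. i \<le> j \<Longrightarrow> j < n \<Longrightarrow> d i \<le> d j"
    and g_pos: "\<And>i. i < n \<Longrightarrow> 0 < g i" and g_norm: "(\<Sum>i<n. t i * ln (g i)) = 0"
    and c_pos: "0 < c" and c: "(\<Sum>i<n. t i) * ln c = (\<Sum>i<n. t i * (ln (d i) - ln (t i)))"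
begin

lemma ln_d_mono: "i \<le> j \<Longrightarrow> j < n \<Longrightarrow> ln (d i) \<le> ln (d j)"
  using d_pos[of i] d_pos[of j] d[of i j] by simp

text \<open>The inequality \<open>1 + ln x \<le> x\<close>, sharp only for \<open>x = 1\<close>, is applied to \<open>x = g i * d j / (c * t i)\<close>,
  because this quotient is \<open>1\<close> at the minimum wherever \<open>p i j\<close> is nonzero. After multiplication by
  \<open>c * t i\<close>, the product \<open>g i * d j\<close> is bounded below by the sum of a function of \<open>i\<close> and the
  mixed term \<open>c * t i * ln (d j)\<close>.\<close>

definition minorant :: "nat \<Rightarrow> nat \<Rightarrow> real" where
  "minorant i j = c * t i * (1 + ln (g i) + ln (d j) - ln c - ln (t i))"

lemma minorant_le:
  assumes "i < n" "j < n"
  shows "minorant i j \<le> g i * d j"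
    and "minorant i j = g i * d j \<Longrightarrow> g i * d j = c * t i"
proof -
  define x where "x = g i * d j / (c * t i)"
  have pos: "0 < g i" "0 < d j" "0 < t i" using assms g_pos d_pos t_pos by auto
  hence x: "0 < x" "g i * d j = c * t i * x" using c_pos by (auto simp: x_def)
  have "minorant i j = c * t i * (1 + ln x)"
    using pos c_pos by (simp add: minorant_def x_def ln_div ln_mult algebra_simps)
  moreover have ct: "0 < c * t i" using pos c_pos by simp
  moreover have "1 + ln x \<le> x" using ln_le_minus_one[OF x(1)] by simp
  ultimately show "minorant i j \<le> g i * d j"
    unfolding x(2) by (simp add: mult_le_cancel_left_pos)
  assume eq: "minorant i j = g i * d j"
  have "c * t i * (1 + ln x) = c * t i * x"
    using x(2) eq \<open>minorant i j = c * t i * (1 + ln x)\<close> by simp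
  hence "ln x = x - 1" using ct by (auto simp: mult_cancel_left)
  hence "x = 1" using ln_eq_minus_one[OF x(1)] by simp
  thus "g i * d j = c * t i" using x(2) by simp
qed

text \<open>By the row sums of \<open>p\<close>, the normalisation of \<open>g\<close> and the choice of \<open>c\<close>, the terms depending
  on \<open>i\<close> alone add up to the claimed bound minus \<open>c * (\<Sum>i<n. t i * ln (d i))\<close>. The mixed term makes
  up for this difference by the rearrangement inequality for \<open>t\<close> and \<open>ln \<circ> d\<close>.\<close>

lemma sum_minorant: "c * (\<Sum>i<n. t i) \<le> (\<Sum>i<n. \<Sum>j<n. p i j * minorant i j)"
proof -
  have "(\<Sum>i<n. \<Sum>j<n. p i j * minorant i j)
      = (\<Sum>i<n. \<Sum>j<n. p i j * (c * t i * (1 + ln (g i) - ln c - ln (t i))))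
        + c * (\<Sum>i<n. \<Sum>j<n. p i j * (t i * ln (d j)))"
    by (simp add: minorant_def sum_distrib_left algebra_simps flip: sum.distrib)
  also have "(\<Sum>i<n. \<Sum>j<n. p i j * (c * t i * (1 + ln (g i) - ln c - ln (t i))))
      = (\<Sum>i<n. c * t i * (1 + ln (g i) - ln c - ln (t i)))"
    by (rule doubly_stochastic_sum_marginals[OF p])
  also have "\<dots> = c * ((\<Sum>i<n. t i) + (\<Sum>i<n. t i * ln (g i)) - (\<Sum>i<n. t i) * ln c
      - (\<Sum>i<n. t i * ln (t i)))"
    by (simp add: sum_distrib_left sum_distrib_right algebra_simps sum.distrib sum_subtractf)
  also have "\<dots> = c * (\<Sum>i<n. t i) - c * (\<Sum>i<n. t i * ln (d i))"
    unfolding g_norm c by (simp add: algebra_simps sum_subtractf)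
  finally have "(\<Sum>i<n. \<Sum>j<n. p i j * minorant i j) = c * (\<Sum>i<n. t i)
      + c * ((\<Sum>i<n. \<Sum>j<n. p i j * (t i * ln (d j))) - (\<Sum>i<n. t i * ln (d i)))"
    by (simp add: algebra_simps)
  moreover have "(\<Sum>i<n. t i * ln (d i)) \<le> (\<Sum>i<n. \<Sum>j<n. p i j * (t i * ln (d j)))"
    using p t ln_d_mono by (rule rearrangement_doubly_stochastic)
  ultimately show ?thesis using c_pos by simp
qed

lemma cost_lower_bound: "c * (\<Sum>i<n. t i) \<le> (\<Sum>i<n. \<Sum>j<n. p i j * (g i * d j))"
proof -
  note sum_minorant
  also have "(\<Sum>i<n. \<Sum>j<n. p i j * minorant i j) \<le> (\<Sum>i<n. \<Sum>j<n. p i j * (g i * d j))"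
    using doubly_stochasticD(1)[OF p] minorant_le(1) by (intro sum_mono mult_left_mono) auto
  finally show ?thesis .
qed

context
  assumes minimal: "(\<Sum>i<n. \<Sum>j<n. p i j * (g i * d j)) = c * (\<Sum>i<n. t i)"
begin

text \<open>Equality in the averaged bound forces equality in each logarithmic inequality of positive weight.\<close>

lemma equality_support:
  assumes ij: "i < n" "j < n" "p i j \<noteq> 0"
  shows "d j = c * t i / g i"
proof -
  define r where "r i j = p i j * (g i * d j - minorant i j)" for i j
  have r: "0 \<le> r i j" if "i < n" "j < n" for i j
    using that doubly_stochasticD(1)[OF p] minorant_le(1) by (simp add: r_def)
  have "(\<Sum>i<n. \<Sum>j<n. r i j) \<le> 0"
    using minimal sum_minorant by (simp add: r_def right_diff_distrib sum_subtractf)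
  moreover have "0 \<le> (\<Sum>j<n. r i j)" if "i < n" for i
    using r that by (intro sum_nonneg) auto
  ultimately have "(\<Sum>i<n. \<Sum>j<n. r i j) = 0"
    using sum_nonneg[of "{..<n}" "\<lambda>i. \<Sum>j<n. r i j"] by simp
  hence "(\<Sum>j<n. r i j) = 0"
    using r ij(1) by (subst (asm) sum_nonneg_eq_0_iff) (auto intro: sum_nonneg)
  hence "r i j = 0"
    using r ij(1,2) by (subst (asm) sum_nonneg_eq_0_iff) auto
  hence "g i * d j = c * t i" using ij minorant_le(2)[of i j] by (simp add: r_def)
  thus ?thesis using g_pos[OF ij(1)] by (simp add: field_simps)
qed

text \<open>The quotients \<open>a i = c * t i / g i\<close> satisfy \<open>\<Sum>i<n. t i * ln (a i) = \<Sum>i<n. t i * ln (d i)\<close>. By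
  \<open>equality_support\<close> the row \<open>p i\<close> lives on indices \<open>j\<close> with \<open>d j = a i\<close>, hence exchanging two
  rows of \<open>p\<close> exchanges the corresponding values of \<open>a\<close>. The rearrangement inequality for the
  exchanged weights says that the exchange does not decrease the sum, so two values in the wrong
  order could only occur at indices with equal \<open>t\<close>, where the order of \<open>g\<close> excludes it.\<close>

lemma equality_sorted:
  assumes g: "\<And>i j. i \<le> j \<Longrightarrow> j < n \<Longrightarrow> g j \<le> g i" and ik: "i \<le> k" "k < n"
  shows "c * t i / g i \<le> c * t k / g k"
proof -
  define a where "a i = c * t i / g i" for i
  have i: "i < n" using ik by simp
  have a_pos: "0 < a i" if "i < n" for i
    using that c_pos t_pos g_pos by (simp add: a_def)
  have ln_a: "t i * ln (a i) = t i * (ln c + ln (t i)) - t i * ln (g i)" if "i < n" for i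
    using that c_pos t_pos[of i] g_pos[of i] by (simp add: a_def ln_div ln_mult algebra_simps)
  have "(\<Sum>i<n. t i * ln (a i)) = (\<Sum>i<n. t i * (ln c + ln (t i)))"
    using ln_a g_norm by (simp add: sum_subtractf)
  also have "\<dots> = (\<Sum>i<n. t i) * ln c + (\<Sum>i<n. t i * ln (t i))"
    by (simp add: distrib_left sum.distrib sum_distrib_right)
  also have "\<dots> = (\<Sum>i<n. t i * ln (d i))"
    unfolding c by (simp add: right_diff_distrib sum_subtractf)
  finally have sum_a: "(\<Sum>i<n. t i * ln (a i)) = (\<Sum>i<n. t i * ln (d i))" .
  have "a i \<le> a k"
  proof (cases "t i = t k")
    case True
    have "g k \<le> g i" using g ik by auto
    thus ?thesis using True c_pos t_pos[OF i] g_pos[OF ik(2)]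
      by (simp add: a_def divide_left_mono)
  next
    case False
    define \<sigma> where "\<sigma> = Transposition.transpose i k"
    have \<sigma>: "bij_betw \<sigma> {..<n} {..<n}"
      using i ik(2) by (intro bij_betwI[where g = \<sigma>]) (auto simp: \<sigma>_def transpose_def)
    have \<sigma>_less: "\<sigma> l < n" if "l < n" for l using bij_betwE[OF \<sigma>] that by auto
    have "doubly_stochastic n (\<lambda>l. p (\<sigma> l))"
      using doubly_stochasticD[OF p] \<sigma>_less
      by (auto simp: doubly_stochastic_def sum.reindex_bij_betw[OF \<sigma>, of "\<lambda>l. p l _"])
    hence "(\<Sum>l<n. t l * ln (d l)) \<le> (\<Sum>l<n. \<Sum>j<n. p (\<sigma> l) j * (t l * ln (d j)))"
      using t ln_d_mono by (rule rearrangement_doubly_stochastic)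
    also have "\<dots> = (\<Sum>l<n. \<Sum>j<n. p (\<sigma> l) j * (t l * ln (a (\<sigma> l))))"
      using equality_support \<sigma>_less by (intro sum.cong refl) (force simp: a_def)
    also have "\<dots> = (\<Sum>l<n. t l * ln (a (\<sigma> l)))"
      using doubly_stochasticD(2)[OF p] \<sigma>_less
      by (intro sum.cong refl) (simp flip: sum_distrib_right)
    finally have "0 \<le> (\<Sum>l<n. t l * (ln (a (\<sigma> l)) - ln (a l)))"
      by (simp add: sum_a right_diff_distrib sum_subtractf)
    also have "\<dots> = (\<Sum>l\<in>{i, k}. t l * (ln (a (\<sigma> l)) - ln (a l)))"
      using i ik(2) by (intro sum.mono_neutral_right) (auto simp: \<sigma>_def transpose_def)
    also have "\<dots> = (t i - t k) * (ln (a k) - ln (a i))"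
    proof -
      have "i \<noteq> k" using False by auto
      thus ?thesis by (simp add: \<sigma>_def algebra_simps)
    qed
    finally have "ln (a i) \<le> ln (a k)"
      using t[OF ik] False by (simp add: zero_le_mult_iff)
    thus ?thesis using a_pos i ik(2) by simp
  qed
  thus ?thesis by (simp add: a_def)
qed

end

end

section \<open>The cost in terms of spectra\<close>

lemma mat_trace_comm:
  assumes "X \<in> carrier_mat n n" "Y \<in> carrier_mat n n"
  shows "mat_trace (X * Y) = mat_trace (Y * X)"
proof -
  have "mat_trace (X * Y) = (\<Sum>i<n. \<Sum>j<n. X $$ (i, j) * Y $$ (j, i))"
    using assms by (simp add: mat_trace_def scalar_prod_def atLeast0LessThan)
  also have "\<dots> = (\<Sum>j<n. \<Sum>i<n. Y $$ (j, i) * X $$ (i, j))"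
    by (subst sum.swap) (simp add: mult.commute)
  also have "\<dots> = mat_trace (Y * X)"
    using assms by (simp add: mat_trace_def scalar_prod_def atLeast0LessThan)
  finally show ?thesis .
qed

text \<open>The trace is cyclic, so the cost depends on \<open>A\<close> through \<open>A\<^sup>*A\<close> only; it is then expanded in the
  eigenbases of the two Hermitian factors.\<close>

lemma cost_conj_diag:
  assumes A: "A \<in> carrier_mat n n" and gram: "mat_adjoint A * A = conj_diag n W g"
    and W: "W \<in> unitary_mats n" and U: "U \<in> unitary_mats n"
  shows "cost (conj_diag n U d) A
    = (\<Sum>i<n. \<Sum>j<n. (cmod ((mat_adjoint W * U) $$ (i, j)))\<^sup>2 * (g i * d j))"
proof -
  note * = unitaryD[OF W] unitaryD[OF U] mat_diag_dim
  define Q where "Q = mat_adjoint W * U"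
  let ?D = "mat_diag n (\<lambda>i. complex_of_real (d i))" and ?G = "mat_diag n (\<lambda>i. complex_of_real (g i))"
  have Q: "Q \<in> carrier_mat n n" using * by (simp add: Q_def square_simps[where n=n])
  have Qadj: "mat_adjoint Q = mat_adjoint U * W"
    using * by (simp add: Q_def mat_adjoint_mult[of _ n n _ n])
  have \<Delta>: "conj_diag n U d \<in> carrier_mat n n" using U by simp
  have "mat_trace (A * conj_diag n U d * mat_adjoint A)
      = mat_trace (A * (conj_diag n U d * mat_adjoint A))"
    using A \<Delta> by (simp add: square_simps[where n=n])
  also have "\<dots> = mat_trace (conj_diag n U d * mat_adjoint A * A)"
    using A \<Delta> by (intro mat_trace_comm[of _ n]) (simp_all add: square_simps[where n=n])
  also have "conj_diag n U d * mat_adjoint A * A = conj_diag n U d * conj_diag n W g"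
    using A \<Delta> by (simp add: square_simps[where n=n] flip: gram)
  also have "\<dots> = U * (?D * (mat_adjoint Q * (?G * mat_adjoint W)))"
    using * by (simp add: conj_diag_def Qadj square_simps[where n=n])
  also have "mat_trace \<dots> = mat_trace (?D * (mat_adjoint Q * (?G * mat_adjoint W)) * U)"
    using * Q by (intro mat_trace_comm[of _ n]) (simp_all add: square_simps[where n=n])
  also have "?D * (mat_adjoint Q * (?G * mat_adjoint W)) * U = ?D * (mat_adjoint Q * (?G * Q))"
    using * by (simp add: Q_def mat_adjoint_mult[of _ n n _ n] square_simps[where n=n])
  also have "mat_trace \<dots> = (\<Sum>j<n. d j * (\<Sum>i<n. cnj (Q $$ (i, j)) * (g i * Q $$ (i, j))))"
  proof -
    have GQ: "?G * Q \<in> carrier_mat n n" and QGQ: "mat_adjoint Q * (?G * Q) \<in> carrier_mat n n"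
      using Q by (simp_all add: square_simps[where n=n])
    have "(mat_adjoint Q * (?G * Q)) $$ (j, j) = (\<Sum>i<n. cnj (Q $$ (i, j)) * (g i * Q $$ (i, j)))"
      if j: "j < n" for j
    proof -
      have "(mat_adjoint Q * (?G * Q)) $$ (j, j) = (\<Sum>i<n. cnj (Q $$ (i, j)) * (?G * Q) $$ (i, j))"
        using Q GQ j by (simp add: scalar_prod_def atLeast0LessThan)
      thus ?thesis using Q j by (simp add: mat_diag_mult_left[OF Q])
    qed
    thus ?thesis using QGQ by (simp add: mat_trace_def mat_diag_mult_left[OF QGQ])
  qed
  also have "\<dots> = (\<Sum>j<n. \<Sum>i<n. complex_of_real ((cmod (Q $$ (i, j)))\<^sup>2 * (g i * d j)))"
    by (simp add: sum_distrib_left complex_norm_square mult_ac del: of_real_power)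
  also have "\<dots> = complex_of_real (\<Sum>i<n. \<Sum>j<n. (cmod (Q $$ (i, j)))\<^sup>2 * (g i * d j))"
    unfolding of_real_sum by (rule sum.swap)
  finally show ?thesis by (simp only: cost_def Q_def Re_complex_of_real)
qed

lemma doubly_stochastic_unitary:
  assumes Q: "Q \<in> unitary_mats n"
  shows "doubly_stochastic n (\<lambda>i j. (cmod (Q $$ (i, j)))\<^sup>2)"
proof -
  note * = unitaryD[OF Q]
  have "complex_of_real (\<Sum>j<n. (cmod (Q $$ (i, j)))\<^sup>2) = 1" if i: "i < n" for i
  proof -
    have "complex_of_real (\<Sum>j<n. (cmod (Q $$ (i, j)))\<^sup>2) = (Q * mat_adjoint Q) $$ (i, i)"
      unfolding of_real_sum using *(1) i
      by (simp add: scalar_prod_def atLeast0LessThan complex_norm_square del: of_real_power)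
    thus ?thesis unfolding *(3) using i by simp
  qed
  moreover have "complex_of_real (\<Sum>i<n. (cmod (Q $$ (i, j)))\<^sup>2) = 1" if j: "j < n" for j
  proof -
    have "complex_of_real (\<Sum>i<n. (cmod (Q $$ (i, j)))\<^sup>2) = (mat_adjoint Q * Q) $$ (j, j)"
      unfolding of_real_sum using *(1) j
      by (simp add: scalar_prod_def atLeast0LessThan complex_norm_square mult.commute del: of_real_power)
    thus ?thesis unfolding *(4) using j by simp
  qed
  ultimately show ?thesis unfolding doubly_stochastic_def of_real_eq_1_iff by simp
qed

section \<open>Singular value decompositions and the constraint set\<close>

lemma gram_svd:
  fixes h :: "nat \<Rightarrow> real"
  assumes V: "V \<in> unitary_mats n" and W: "W \<in> unitary_mats n"
  defines "A \<equiv> V * mat_diag n (\<lambda>i. complex_of_real (h i)) * mat_adjoint W"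
  shows "A \<in> carrier_mat n n" "mat_adjoint A * A = conj_diag n W (\<lambda>i. (h i)\<^sup>2)"
proof -
  note * = unitaryD[OF V] unitaryD[OF W] mat_diag_dim
  let ?D = "mat_diag n (\<lambda>i. complex_of_real (h i))"
  show "A \<in> carrier_mat n n"
    using * by (simp add: A_def square_simps[where n=n])
  have "mat_adjoint A = W * (?D * mat_adjoint V)"
    using * unfolding A_def
    by (simp add: mat_adjoint_mult[of _ n n _ n] mat_adjoint_diag_real square_simps[where n=n])
  moreover have "A = V * (?D * mat_adjoint W)"
    using * unfolding A_def by (simp add: square_simps[where n=n])
  ultimately have "mat_adjoint A * A = W * (?D * (mat_adjoint V * (V * (?D * mat_adjoint W))))"
    using * by (simp add: square_simps[where n=n])
  also have "\<dots> = W * (?D * (?D * mat_adjoint W))"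
    using * unitary_cancel(1)[OF V, of "?D * mat_adjoint W" n] by (simp add: square_simps[where n=n])
  also have "\<dots> = W * (?D * ?D * mat_adjoint W)"
    using * by (simp only: square_simps[where n=n] mat_diag_dim)
  finally show "mat_adjoint A * A = conj_diag n W (\<lambda>i. (h i)\<^sup>2)"
    using * by (simp add: conj_diag_def power2_eq_square square_simps[where n=n])
qed

text \<open>The columns of \<open>A W\<close> are orthogonal with squared norms \<open>g i\<close>. As these are positive, the
  columns can be normalised, which gives \<open>V\<close>.\<close>

lemma svd_of_gram:
  assumes A: "A \<in> carrier_mat n n" and gram: "mat_adjoint A * A = conj_diag n W g"
    and W: "W \<in> unitary_mats n" and g: "\<And>i. i < n \<Longrightarrow> 0 < g i"
  obtains V where "V \<in> unitary_mats n"
    "A = V * mat_diag n (\<lambda>i. complex_of_real (sqrt (g i))) * mat_adjoint W"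
proof -
  note * = unitaryD[OF W] mat_diag_dim
  define S where "S = mat_diag n (\<lambda>i. complex_of_real (sqrt (g i)))"
  define R where "R = mat_diag n (\<lambda>i. complex_of_real (1 / sqrt (g i)))"
  define G where "G = mat_diag n (\<lambda>i. complex_of_real (g i))"
  have dims: "S \<in> carrier_mat n n" "R \<in> carrier_mat n n" "G \<in> carrier_mat n n"
    by (simp_all add: S_def R_def G_def)
  have "R * S = mat_diag n (\<lambda>_. 1)"
    unfolding R_def S_def mat_diag_diag using g by (intro mat_diag_cong) (force simp flip: of_real_mult)
  hence RS: "R * S = 1\<^sub>m n" by simp
  have "R * G * R = mat_diag n (\<lambda>_. 1)"
    unfolding R_def G_def mat_diag_diag using g
    by (intro mat_diag_cong) (force simp: field_simps simp flip: of_real_mult)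
  hence RGR: "R * (G * R) = 1\<^sub>m n" using dims by (simp add: square_simps[where n=n])
  have Radj: "mat_adjoint R = R" unfolding R_def by (rule mat_adjoint_diag_real)
  define V where "V = A * (W * R)"
  have V: "V \<in> carrier_mat n n" using A * dims by (simp add: V_def square_simps[where n=n])
  have "mat_adjoint V * V = R * (mat_adjoint W * (mat_adjoint A * A * (W * R)))"
    using A * dims by (simp add: V_def mat_adjoint_mult[of _ n n _ n] Radj square_simps[where n=n])
  also have "\<dots> = R * (mat_adjoint W * (W * (G * (mat_adjoint W * (W * R)))))"
    using * dims by (simp add: gram conj_diag_def square_simps[where n=n] flip: G_def)
  also have "\<dots> = R * (G * R)"
    using * dims unitary_cancel(1)[OF W, of R n] unitary_cancel(1)[OF W, of "G * R" n]
    by (simp add: square_simps[where n=n])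
  finally have "V \<in> unitary_mats n" using V by (intro unitaryI) (simp_all add: RGR)
  moreover have "V * S * mat_adjoint W = A * (W * (R * S * mat_adjoint W))"
    using A * dims by (simp add: V_def square_simps[where n=n])
  hence "A = V * S * mat_adjoint W" using A * by (simp add: RS)
  ultimately show ?thesis by (intro that) (simp_all add: S_def)
qed

text \<open>A vanishing factor makes the product vanish since \<open>0 powr s = 0\<close>, so the equation forces all
  \<open>g i\<close> to be positive; it is then linearised by the logarithm.\<close>

lemma prod_sqrt_powr_eq_1_iff:
  fixes g s :: "nat \<Rightarrow> real"
  assumes g: "\<And>i. i < n \<Longrightarrow> 0 \<le> g i"
  shows "(\<Prod>i<n. sqrt (g i) powr s i) = 1 \<longleftrightarrow> (\<forall>i<n. 0 < g i) \<and> (\<Sum>i<n. s i * ln (g i)) = 0"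
proof (cases "\<forall>i<n. 0 < g i")
  case True
  have "(\<Prod>i<n. sqrt (g i) powr s i) = (\<Prod>i<n. exp (s i * ln (g i) / 2))"
    using True by (intro prod.cong refl) (auto simp: powr_def ln_sqrt)
  also have "\<dots> = exp ((\<Sum>i<n. s i * ln (g i)) / 2)"
    by (simp add: exp_sum sum_divide_distrib)
  finally show ?thesis using True by simp
next
  case False
  then obtain i where "i < n" "g i = 0" using g by (meson linorder_not_less order_antisym)
  hence prod_0: "(\<Prod>i<n. sqrt (g i) powr s i) = 0" by (intro prod_zero) auto
  show ?thesis unfolding prod_0 using False by simp
qed

lemma S_mats_iff:
  assumes A: "A \<in> carrier_mat n n" and W: "W \<in> unitary_mats n"
    and gram: "mat_adjoint A * A = conj_diag n W g"
    and g: "\<And>i j. i \<le> j \<Longrightarrow> j < n \<Longrightarrow> g j \<le> g i" and g0: "\<And>i. i < n \<Longrightarrow> 0 \<le> g i"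
  shows "A \<in> S_mats n t \<longleftrightarrow> (\<forall>i<n. 0 < g i) \<and> (\<Sum>i<n. t (Suc i) * ln (g i)) = 0"
proof -
  have "(\<Prod>j=1..n. sing_val A j powr t j) = (\<Prod>i<n. sing_val A (Suc i) powr t (Suc i))"
    by (rule prod.reindex_bij_witness[of _ Suc "\<lambda>j. j - 1"]) auto
  also have "\<dots> = (\<Prod>i<n. sqrt (g i) powr t (Suc i))"
    using eigval_conj_diag_antimono[OF W g] by (intro prod.cong refl) (simp add: sing_val_def gram)
  finally show ?thesis using A prod_sqrt_powr_eq_1_iff[OF g0] by (simp add: S_mats_def)
qed

lemma S_mats_gram:
  assumes A: "A \<in> S_mats n t"
  obtains W g where "W \<in> unitary_mats n" "mat_adjoint A * A = conj_diag n W g"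
    "\<And>i j. i \<le> j \<Longrightarrow> j < n \<Longrightarrow> g j \<le> g i" "\<And>i. i < n \<Longrightarrow> 0 < g i"
    "(\<Sum>i<n. t (Suc i) * ln (g i)) = 0"
proof -
  let ?G = "mat_adjoint A * A" and ?g = "\<lambda>i. eigval (mat_adjoint A * A) (Suc i)"
  have A': "A \<in> carrier_mat n n" using A by (simp add: S_mats_def)
  have G: "?G \<in> nonneg_mats n" by (rule gram_nonneg[OF A'])
  then obtain W where W: "W \<in> unitary_mats n" "?G = conj_diag n W ?g"
    using hermitian_conj_diag_antimono[of ?G n] by (auto simp: nonneg_mats_def)
  have "?G \<in> carrier_mat n n" using G by (simp add: nonneg_mats_def hermitian_mats_def)
  hence mono: "?g j \<le> ?g i" if "i \<le> j" "j < n" for i j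
    using that by (intro eigval_antimono) auto
  have "0 \<le> ?g i" if "i < n" for i
    using nonneg_conj_diag[of n W ?g i] G W that by simp
  thus ?thesis using that[OF W mono] S_mats_iff[OF A' W mono] A by blast
qed

lemma svd_in_S_mats:
  assumes V: "V \<in> unitary_mats n" and U: "U \<in> unitary_mats n"
    and g: "\<And>i j. i \<le> j \<Longrightarrow> j < n \<Longrightarrow> g j \<le> g i" and g_pos: "\<And>i. i < n \<Longrightarrow> 0 < g i"
    and norm: "(\<Sum>i<n. t (Suc i) * ln (g i)) = 0"
  defines "A \<equiv> V * mat_diag n (\<lambda>i. complex_of_real (sqrt (g i))) * mat_adjoint U"
  shows "A \<in> S_mats n t" "cost (conj_diag n U d) A = (\<Sum>i<n. g i * d i)"
proof -
  have A: "A \<in> carrier_mat n n" unfolding A_def by (rule gram_svd[OF V U])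
  have "mat_adjoint A * A = conj_diag n U (\<lambda>i. (sqrt (g i))\<^sup>2)"
    unfolding A_def by (rule gram_svd[OF V U])
  also have "\<dots> = conj_diag n U g"
    using g_pos by (intro conj_diag_cong) (simp add: less_imp_le)
  finally have gram: "mat_adjoint A * A = conj_diag n U g" .
  show "A \<in> S_mats n t"
    using S_mats_iff[OF A U gram g] g_pos norm by (simp add: less_imp_le)
  have "cost (conj_diag n U d) A
      = (\<Sum>i<n. \<Sum>j<n. (cmod ((mat_adjoint U * U) $$ (i, j)))\<^sup>2 * (g i * d j))"
    by (rule cost_conj_diag[OF A gram U U])
  also have "\<dots> = (\<Sum>i<n. \<Sum>j<n. if j = i then g i * d i else 0)"
    unfolding unitaryD(4)[OF U] by (intro sum.cong refl) auto
  finally show "cost (conj_diag n U d) A = (\<Sum>i<n. g i * d i)" by simp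
qed

lemma S_mats_cost_expansion:
  assumes A: "A \<in> S_mats n t" and U: "U \<in> unitary_mats n"
  obtains W g where "W \<in> unitary_mats n" "mat_adjoint A * A = conj_diag n W g"
    "\<And>i j. i \<le> j \<Longrightarrow> j < n \<Longrightarrow> g j \<le> g i" "\<And>i. i < n \<Longrightarrow> 0 < g i"
    "(\<Sum>i<n. t (Suc i) * ln (g i)) = 0"
    "doubly_stochastic n (\<lambda>i j. (cmod ((mat_adjoint W * U) $$ (i, j)))\<^sup>2)"
    "cost (conj_diag n U d) A
      = (\<Sum>i<n. \<Sum>j<n. (cmod ((mat_adjoint W * U) $$ (i, j)))\<^sup>2 * (g i * d j))"
proof -
  obtain W g where *: "W \<in> unitary_mats n" "mat_adjoint A * A = conj_diag n W g"
    "\<And>i j. i \<le> j \<Longrightarrow> j < n \<Longrightarrow> g j \<le> g i" "\<And>i. i < n \<Longrightarrow> 0 < g i"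
    "(\<Sum>i<n. t (Suc i) * ln (g i)) = 0"
    using S_mats_gram[OF A] by blast
  have "A \<in> carrier_mat n n" using A by (simp add: S_mats_def)
  from cost_conj_diag[OF this *(2,1) U]
  show ?thesis
    using that[OF *] doubly_stochastic_unitary[OF unitary_mult[OF unitary_adjoint[OF *(1)] U]] by simp
qed

section \<open>Singular weights\<close>

text \<open>A matrix satisfying the constraint is injective. In the expansion of the cost every \<open>d j\<close>
  therefore has a positive total coefficient, as the column sums of the weights are \<open>1\<close>.\<close>

lemma cost_nonneg_definite:
  assumes A: "A \<in> S_mats n t" and U: "U \<in> unitary_mats n" and d: "\<And>i. i < n \<Longrightarrow> 0 \<le> d i"
  shows "0 \<le> cost (conj_diag n U d) A"
    and "cost (conj_diag n U d) A = 0 \<Longrightarrow> j < n \<Longrightarrow> d j = 0"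
proof -
  obtain W g where g: "\<And>i. i < n \<Longrightarrow> 0 < g i"
    and p: "doubly_stochastic n (\<lambda>i j. (cmod ((mat_adjoint W * U) $$ (i, j)))\<^sup>2)"
    and cost: "cost (conj_diag n U d) A
      = (\<Sum>i<n. \<Sum>j<n. (cmod ((mat_adjoint W * U) $$ (i, j)))\<^sup>2 * (g i * d j))"
    by (rule S_mats_cost_expansion[OF A U, of d]) blast
  define p where "p i j = (cmod ((mat_adjoint W * U) $$ (i, j)))\<^sup>2" for i j
  have nn: "0 \<le> p i j * (g i * d j)" if "i < n" "j < n" for i j
    using that g[of i] d[of j] by (simp add: p_def)
  hence row: "0 \<le> (\<Sum>j<n. p i j * (g i * d j))" if "i < n" for i
    using that by (intro sum_nonneg) auto
  show "0 \<le> cost (conj_diag n U d) A"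
    unfolding cost p_def[symmetric] using row by (auto intro: sum_nonneg)
  assume "cost (conj_diag n U d) A = 0" and j: "j < n"
  hence "(\<Sum>i<n. \<Sum>j<n. p i j * (g i * d j)) = 0" by (simp add: cost p_def)
  hence row_0: "(\<Sum>j<n. p i j * (g i * d j)) = 0" if "i < n" for i
    using row that by (subst (asm) sum_nonneg_eq_0_iff) auto
  have "p i j * (g i * d j) = 0" if "i < n" for i
    using row_0[OF that] nn[OF that] j by (subst (asm) sum_nonneg_eq_0_iff) auto
  hence "p i j * d j = 0" if "i < n" for i using g[OF that] that by fastforce
  hence "(\<Sum>i<n. p i j * d j) = 0" by (intro sum.neutral) auto
  thus "d j = 0"
    using doubly_stochasticD(3)[OF p j] by (simp add: p_def flip: sum_distrib_right)
qed

text \<open>The first right singular vector spans a direction of zero weight. Its singular value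
  may be taken so large, at no cost, that all the other squared singular values can equal \<open>\<delta>\<close>.\<close>

lemma S_mats_small_cost:
  assumes n: "0 < n" and t: "\<And>i. i < n \<Longrightarrow> 0 < t (Suc i)" and U: "U \<in> unitary_mats n"
    and d0: "d 0 = 0" and \<delta>: "0 < \<delta>" "\<delta> \<le> 1"
  shows "\<exists>A \<in> S_mats n t. cost (conj_diag n U d) A = \<delta> * (\<Sum>i<n. d i)"
proof -
  obtain m where m: "n = Suc m" using n by (cases n) auto
  \<comment> \<open>\<open>exp r\<close> is the squared singular value that balances \<open>\<delta>\<close> in the constraint.\<close>
  define r where "r = - (\<Sum>i<m. t (Suc (Suc i))) * ln \<delta> / t 1"
  define g where "g i = (if i = 0 then exp r else \<delta>)" for i :: nat
  have t1: "0 < t 1" using t[of 0] n by simp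
  have "0 \<le> (\<Sum>i<m. t (Suc (Suc i)))" using t m by (intro sum_nonneg) (simp add: less_imp_le)
  hence "0 \<le> r" using \<delta> t1 by (simp add: r_def mult_nonneg_nonpos divide_nonpos_pos)
  hence "\<delta> \<le> exp r" using \<delta> by (meson one_le_exp_iff order_trans)
  hence mono: "g j \<le> g i" if "i \<le> j" "j < n" for i j
    using that by (auto simp: g_def)
  have pos: "0 < g i" if "i < n" for i using \<delta> by (simp add: g_def)
  have "(\<Sum>i<n. t (Suc i) * ln (g i)) = t 1 * r + (\<Sum>i<m. t (Suc (Suc i)) * ln \<delta>)"
    unfolding m by (simp add: sum.lessThan_Suc_shift g_def del: sum.lessThan_Suc)
  also have "\<dots> = 0" using t1 by (simp add: r_def sum_distrib_right)
  finally have norm: "(\<Sum>i<n. t (Suc i) * ln (g i)) = 0" .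
  have "(\<Sum>i<n. g i * d i) = \<delta> * (\<Sum>i<n. d i)"
    unfolding sum_distrib_left using d0 by (intro sum.cong refl) (auto simp: g_def)
  thus ?thesis
    using svd_in_S_mats(1)[OF unitary_one U mono pos norm]
      svd_in_S_mats(2)[OF unitary_one U mono pos norm, of d] by force
qed

lemma iota_singular:
  assumes n: "0 < n" and t: "\<And>i. i < n \<Longrightarrow> 0 < t (Suc i)"
    and \<Delta>: "\<Delta> \<in> nonneg_mats n" and sing: "\<not> invertible_mat \<Delta>"
  shows "iota \<Delta> (S_mats n t) = 0" "attained \<Delta> (S_mats n t) \<longleftrightarrow> \<Delta> = 0\<^sub>m n n"
proof -
  define d where "d = (\<lambda>i. eigval \<Delta> (n - i))"
  have herm: "\<Delta> \<in> hermitian_mats n" and carr: "\<Delta> \<in> carrier_mat n n"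
    using \<Delta> by (auto simp: nonneg_mats_def hermitian_mats_def)
  obtain U where "U \<in> diagonalizers n \<Delta>"
    using hermitian_diagonalizers[OF herm] by blast
  hence U: "U \<in> unitary_mats n" and \<Delta>U: "\<Delta> = conj_diag n U d"
    unfolding diagonalizers_iff d_def by blast+
  have d: "0 \<le> d i" if "i < n" for i using eigval_nonneg[OF \<Delta> that] by (simp add: d_def)
  obtain i where i: "i < n" "d i = 0"
    using sing invertible_conj_diag[OF U, of d] unfolding \<Delta>U by auto
  have d0: "d 0 = 0"
    using eigval_ascending[OF carr, of 0 i] i d[OF n] by (simp add: d_def)
  have small: "\<exists>A \<in> S_mats n t. cost \<Delta> A = \<delta> * (\<Sum>i<n. d i)" if "0 < \<delta>" "\<delta> \<le> 1" for \<delta>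
    unfolding \<Delta>U using S_mats_small_cost[of n t U d \<delta>] n t U d0 that by blast
  have ne: "S_mats n t \<noteq> {}" using small[of 1] by auto
  have nonneg: "0 \<le> cost \<Delta> A" if "A \<in> S_mats n t" for A
    unfolding \<Delta>U using that U d by (rule cost_nonneg_definite)
  have bdd: "bdd_below (cost \<Delta> ` S_mats n t)" using nonneg by (intro bdd_belowI2)
  show iota: "iota \<Delta> (S_mats n t) = 0"
  proof (rule antisym)
    show "iota \<Delta> (S_mats n t) \<le> 0"
    proof (rule field_le_epsilon)
      fix e :: real assume e: "0 < e"
      define D where "D = (\<Sum>i<n. d i)"
      have D: "0 \<le> D" unfolding D_def using d by (intro sum_nonneg) auto
      \<comment> \<open>The summand \<open>1\<close> covers the case \<open>D = 0\<close>.\<close>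
      define \<delta> where "\<delta> = min 1 (e / (D + 1))"
      have \<delta>: "0 < \<delta>" "\<delta> \<le> 1" using e D by (auto simp: \<delta>_def)
      obtain A where A: "A \<in> S_mats n t" "cost \<Delta> A = \<delta> * D"
        using small[OF \<delta>] by (auto simp: D_def)
      have "iota \<Delta> (S_mats n t) \<le> \<delta> * D"
        unfolding iota_def A(2)[symmetric] using bdd A(1) by (rule cINF_lower)
      also have "\<dots> \<le> e / (D + 1) * (D + 1)"
        using D e by (intro mult_mono) (auto simp: \<delta>_def)
      finally show "iota \<Delta> (S_mats n t) \<le> 0 + e" using D by simp
    qed
    show "0 \<le> iota \<Delta> (S_mats n t)"
      unfolding iota_def using ne nonneg by (rule cINF_greatest)
  qed
  show "attained \<Delta> (S_mats n t) \<longleftrightarrow> \<Delta> = 0\<^sub>m n n"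
  proof
    assume "attained \<Delta> (S_mats n t)"
    then obtain A where A: "A \<in> S_mats n t" "cost \<Delta> A = 0"
      by (auto simp: attained_def minimizers_def iota)
    have "d j = 0" if "j < n" for j
      using cost_nonneg_definite(2)[OF A(1) U, of d j] d A(2) that by (simp add: \<Delta>U)
    hence "\<Delta> = conj_diag n U (\<lambda>_. 0)" unfolding \<Delta>U by (intro conj_diag_cong)
    also have "mat_diag n (\<lambda>i. complex_of_real 0) = 0\<^sub>m n n"
      by (rule eq_matI) (auto simp: mat_diag_def)
    hence "conj_diag n U (\<lambda>_. 0) = 0\<^sub>m n n"
      using unitaryD[OF U] by (simp add: conj_diag_def)
    finally show "\<Delta> = 0\<^sub>m n n" .
  next
    assume 0: "\<Delta> = 0\<^sub>m n n"
    obtain A where A: "A \<in> S_mats n t" using ne by auto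
    have "A \<in> carrier_mat n n" using A by (simp add: S_mats_def)
    hence "cost \<Delta> A = 0" by (simp add: 0 cost_def mat_trace_def)
    thus "attained \<Delta> (S_mats n t)" using A iota by (auto simp: attained_def minimizers_def)
  qed
qed

section \<open>Regular weights\<close>

text \<open>If a competitor attains the bound, \<open>equality_support\<close> says that \<open>Q = W\<^sup>*U\<^sub>0\<close> intertwines the
  diagonal matrices of \<open>a\<close> and of \<open>d\<close>. Hence the right singular vectors of \<open>A\<close> diagonalise
  \<open>\<Delta>\<close>, and since \<open>a\<close> is increasing they do so in the required order. The singular values are
  then read off from \<open>a = d\<close>.\<close>

lemma cost_minimum:
  assumes \<Delta>: "\<Delta> \<in> carrier_mat n n" and diag: "diagonalizers n \<Delta> \<noteq> {}"
    and d_pos: "\<And>i. i < n \<Longrightarrow> 0 < d i" and d_eigval: "d = (\<lambda>i. eigval \<Delta> (n - i))"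
    and t_pos: "\<And>i. i < n \<Longrightarrow> 0 < t (Suc i)"
    and t_mono: "\<And>i j. i \<le> j \<Longrightarrow> j < n \<Longrightarrow> t (Suc j) \<le> t (Suc i)"
    and c_pos: "0 < c"
    and c: "(\<Sum>i<n. t (Suc i)) * ln c = (\<Sum>i<n. t (Suc i) * (ln (d i) - ln (t (Suc i))))"
  defines "opt V U \<equiv> V * mat_diag n (\<lambda>i. complex_of_real (sqrt (c * t (Suc i) / d i))) * mat_adjoint U"
  shows "A \<in> S_mats n t \<Longrightarrow> c * (\<Sum>i<n. t (Suc i)) \<le> cost \<Delta> A"
    and "A \<in> S_mats n t \<Longrightarrow> cost \<Delta> A = c * (\<Sum>i<n. t (Suc i))
      \<Longrightarrow> \<exists>V \<in> unitary_mats n. \<exists>U \<in> diagonalizers n \<Delta>. A = opt V U"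
    and "V \<in> unitary_mats n \<Longrightarrow> U \<in> diagonalizers n \<Delta> \<Longrightarrow> opt V U \<in> S_mats n t"
    and "V \<in> unitary_mats n \<Longrightarrow> U \<in> diagonalizers n \<Delta>
      \<Longrightarrow> cost \<Delta> (opt V U) = c * (\<Sum>i<n. t (Suc i))"
proof -
  have d_mono: "d i \<le> d j" if "i \<le> j" "j < n" for i j
    using eigval_ascending[OF \<Delta> that] by (simp add: d_eigval)
  note d_fun = d_eigval[symmetric]
  obtain U\<^sub>0 where "U\<^sub>0 \<in> diagonalizers n \<Delta>" using diag by blast
  hence U\<^sub>0: "U\<^sub>0 \<in> unitary_mats n" and \<Delta>U\<^sub>0: "\<Delta> = conj_diag n U\<^sub>0 d"
    unfolding diagonalizers_iff d_fun by blast+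
  {
    assume A: "A \<in> S_mats n t"
    obtain W g where W: "W \<in> unitary_mats n" and gram: "mat_adjoint A * A = conj_diag n W g"
      and g_mono: "\<And>i j. i \<le> j \<Longrightarrow> j < n \<Longrightarrow> g j \<le> g i" and g_pos: "\<And>i. i < n \<Longrightarrow> 0 < g i"
      and g_norm: "(\<Sum>i<n. t (Suc i) * ln (g i)) = 0"
      and ds: "doubly_stochastic n (\<lambda>i j. (cmod ((mat_adjoint W * U\<^sub>0) $$ (i, j)))\<^sup>2)"
      and cost: "cost (conj_diag n U\<^sub>0 d) A
        = (\<Sum>i<n. \<Sum>j<n. (cmod ((mat_adjoint W * U\<^sub>0) $$ (i, j)))\<^sup>2 * (g i * d j))"
      by (rule S_mats_cost_expansion[OF A U\<^sub>0, of d]) blast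
    define Q where "Q = mat_adjoint W * U\<^sub>0"
    define p where "p = (\<lambda>i j. (cmod (Q $$ (i, j)))\<^sup>2)"
    interpret cost_data n "\<lambda>i. t (Suc i)" d g c p
      using ds t_pos t_mono d_pos d_mono g_pos g_norm c_pos c
      by unfold_locales (auto simp: p_def Q_def)
    have cost': "cost \<Delta> A = (\<Sum>i<n. \<Sum>j<n. p i j * (g i * d j))"
      by (simp add: \<Delta>U\<^sub>0 cost p_def Q_def)
    show "c * (\<Sum>i<n. t (Suc i)) \<le> cost \<Delta> A"
      unfolding cost' by (rule cost_lower_bound)
    assume "cost \<Delta> A = c * (\<Sum>i<n. t (Suc i))"
    hence min: "(\<Sum>i<n. \<Sum>j<n. p i j * (g i * d j)) = c * (\<Sum>i<n. t (Suc i))"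
      by (simp add: cost')
    define a where "a i = c * t (Suc i) / g i" for i
    let ?diag = "\<lambda>f. mat_diag n (\<lambda>i. complex_of_real (f i))"
    note * = unitaryD[OF W] unitaryD[OF U\<^sub>0] mat_diag_dim
    have Q: "Q \<in> carrier_mat n n" using * by (simp add: Q_def square_simps[where n=n])
    have "Q $$ (i, j) * d j = a i * Q $$ (i, j)" if "i < n" "j < n" for i j
      using equality_support[OF min that] by (cases "p i j = 0") (auto simp: p_def a_def)
    \<comment> \<open>Entrywise intertwining turns the eigenbasis \<open>U\<^sub>0\<close> of \<open>\<Delta>\<close> into the eigenbasis \<open>W\<close>.\<close>
    hence QD: "Q * ?diag d = ?diag a * Q"
      unfolding mat_diag_mult_left[OF Q] mat_diag_mult_right[OF Q] by (intro cong_mat) auto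
    have "U\<^sub>0 = W * Q"
      using * unitary_cancel(2)[OF W, of U\<^sub>0 n] by (simp add: Q_def)
    hence "\<Delta> = W * (Q * ?diag d) * mat_adjoint U\<^sub>0"
      using * Q by (simp add: \<Delta>U\<^sub>0 conj_diag_def square_simps[where n=n])
    also have "\<dots> = W * (?diag a * (mat_adjoint W * (U\<^sub>0 * mat_adjoint U\<^sub>0)))"
      using * Q unfolding QD by (simp add: Q_def square_simps[where n=n])
    also have "\<dots> = conj_diag n W a"
      unfolding *(7) using * by (simp add: conj_diag_def square_simps[where n=n])
    finally have \<Delta>W: "\<Delta> = conj_diag n W a" .
    have a_mono: "a i \<le> a j" if "i \<le> j" "j < n" for i j
      unfolding a_def by (rule equality_sorted[OF min g_mono that])
    have ad: "a i = d i" if "i < n" for i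
      using eigval_conj_diag_mono[OF W a_mono that] by (simp add: d_eigval \<Delta>W)
    have "conj_diag n W a = conj_diag n W d" using ad by (rule conj_diag_cong)
    hence WD: "W \<in> diagonalizers n \<Delta>"
      unfolding diagonalizers_iff d_fun using W \<Delta>W by simp
    have "A \<in> carrier_mat n n" using A by (simp add: S_mats_def)
    then obtain V where V: "V \<in> unitary_mats n"
      "A = V * mat_diag n (\<lambda>i. complex_of_real (sqrt (g i))) * mat_adjoint W"
      using gram W g_pos by (rule svd_of_gram)
    have "g i = c * t (Suc i) / d i" if "i < n" for i
      using ad[OF that] g_pos[OF that] d_pos[OF that] by (simp add: a_def field_simps)
    hence "mat_diag n (\<lambda>i. complex_of_real (sqrt (g i)))
        = mat_diag n (\<lambda>i. complex_of_real (sqrt (c * t (Suc i) / d i)))"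
      by (intro mat_diag_cong) simp
    thus "\<exists>V \<in> unitary_mats n. \<exists>U \<in> diagonalizers n \<Delta>. A = opt V U"
      using V WD by (auto simp: opt_def)
  next
    assume V: "V \<in> unitary_mats n" and "U \<in> diagonalizers n \<Delta>"
    hence U: "U \<in> unitary_mats n" "\<Delta> = conj_diag n U d" by (auto simp: diagonalizers_iff d_fun)
    define g where "g i = c * t (Suc i) / d i" for i
    have g_pos: "0 < g i" if "i < n" for i using that c_pos t_pos d_pos by (simp add: g_def)
    have g_mono: "g j \<le> g i" if "i \<le> j" "j < n" for i j
      using that c_pos t_pos[of j] d_pos[of i] t_mono[of i j] d_mono[of i j]
      unfolding g_def by (intro frac_le mult_left_mono) auto
    have "ln (g i) = ln c - (ln (d i) - ln (t (Suc i)))" if "i < n" for i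
      using c_pos t_pos[OF that] d_pos[OF that] by (simp add: g_def ln_div ln_mult)
    hence "(\<Sum>i<n. t (Suc i) * ln (g i))
        = (\<Sum>i<n. t (Suc i) * ln c - t (Suc i) * (ln (d i) - ln (t (Suc i))))"
      by (simp add: right_diff_distrib)
    also have "\<dots> = 0"
      by (simp add: sum_subtractf c flip: sum_distrib_right)
    finally have g_norm: "(\<Sum>i<n. t (Suc i) * ln (g i)) = 0" .
    show "opt V U \<in> S_mats n t"
      using svd_in_S_mats(1)[OF V U(1) g_mono g_pos g_norm] by (simp add: opt_def g_def)
    have "(\<Sum>i<n. g i * d i) = (\<Sum>i<n. c * t (Suc i))"
      using d_pos by (intro sum.cong refl) (force simp: g_def)
    thus "cost \<Delta> (opt V U) = c * (\<Sum>i<n. t (Suc i))"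
      using svd_in_S_mats(2)[OF V U(1) g_mono g_pos g_norm, of d, folded U(2)]
      by (simp add: opt_def g_def sum_distrib_left)
  }
qed

lemma smult_svd:
  assumes V: "V \<in> unitary_mats n" and U: "U \<in> unitary_mats n"
  shows "k \<cdot>\<^sub>m (V * mat_diag n f * mat_adjoint U) = V * mat_diag n (\<lambda>i. k * f i) * mat_adjoint U"
proof -
  note * = unitaryD[OF V] unitaryD[OF U]
  have "mat_diag n (\<lambda>i. k * f i) = k \<cdot>\<^sub>m mat_diag n f"
    by (rule eq_matI) (auto simp: mat_diag_def)
  thus ?thesis
    using * by (simp add: mult_smult_distrib[of _ n n _ n]
        mult_smult_assoc_mat[of _ n n _ n] square_simps[where n=n])
qed

lemma ln_weighted_geometric_mean:
  fixes s b :: "nat \<Rightarrow> real"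
  assumes T: "T = (\<Sum>i<n. s i)" "0 < T" and b: "\<And>i. i < n \<Longrightarrow> 0 < b i"
  defines "c \<equiv> (\<Prod>i<n. b i powr s i) powr (1 / T)"
  shows "0 < c" "T * ln c = (\<Sum>i<n. s i * ln (b i))"
proof -
  have "0 < b i powr s i" if "i < n" for i using b[OF that] by simp
  hence prod: "0 < (\<Prod>i<n. b i powr s i)" by (intro prod_pos) blast
  thus "0 < c" unfolding c_def powr_gt_zero by (rule less_imp_neq[THEN not_sym])
  have "T * ln c = ln (\<Prod>i<n. b i powr s i)"
    using prod T(2) by (simp add: c_def ln_powr)
  also have "\<dots> = (\<Sum>i<n. s i * ln (b i))"
    using b by (subst ln_prod) (force simp: ln_powr)+
  finally show "T * ln c = (\<Sum>i<n. s i * ln (b i))" .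
qed

theorem proposition5p1:
  fixes n :: nat and t lam :: "nat \<Rightarrow> real" and T :: real and \<Delta> :: "complex mat"
  assumes "0 < n"
    and "\<forall>j\<in>{1..n}. 0 < t j"
    and "T = (\<Sum>j=1..n. t j)"
    and "\<Delta> \<in> nonneg_mats n"
    and "\<forall>j\<in>{1..n}. lam j = eigval \<Delta> j"
  shows
    "(\<not> invertible_mat \<Delta> \<longrightarrow>
        iota \<Delta> (S_mats n t) = 0 \<and>
        (attained \<Delta> (S_mats n t) \<longleftrightarrow> \<Delta> = 0\<^sub>m n n))
     \<and>
     ((\<forall>i\<in>{1..n}. \<forall>j\<in>{1..n}. i \<le> j \<longrightarrow> t j \<le> t i) \<longrightarrow> invertible_mat \<Delta> \<longrightarrow>
        attained \<Delta> (S_mats n t) \<and>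
        iota \<Delta> (S_mats n t) =
          T * (\<Prod>j=1..n. (lam (n - j + 1) * inverse (t j)) powr t j) powr (1 / T) \<and>
        minimizers \<Delta> (S_mats n t) =
          {complex_of_real (T powr (-1/2) * iota \<Delta> (S_mats n t) powr (1/2)) \<cdot>\<^sub>m
             (V * mat_diag n (\<lambda>i. complex_of_real
                     ((t (i + 1) * inverse (lam (n - i))) powr (1/2)))
                * mat_adjoint U)
           | V U. V \<in> unitary_mats n \<and> U \<in> diagonalizers n \<Delta>})"
proof -
  have t: "0 < t (Suc i)" if "i < n" for i using assms(2) that by simp
  have herm: "\<Delta> \<in> hermitian_mats n" and \<Delta>: "\<Delta> \<in> carrier_mat n n"
    using assms(4) by (auto simp: nonneg_mats_def hermitian_mats_def)
  have T: "T = (\<Sum>i<n. t (Suc i))"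
    unfolding assms(3) by (rule sum.reindex_bij_witness[of _ Suc "\<lambda>j. j - 1"]) auto
  have T_pos: "0 < T" unfolding T using t assms(1) by (intro sum_pos) auto
  have regular: "attained \<Delta> (S_mats n t) \<and>
        iota \<Delta> (S_mats n t) =
          T * (\<Prod>j=1..n. (lam (n - j + 1) * inverse (t j)) powr t j) powr (1 / T) \<and>
        minimizers \<Delta> (S_mats n t) =
          {complex_of_real (T powr (-1/2) * iota \<Delta> (S_mats n t) powr (1/2)) \<cdot>\<^sub>m
             (V * mat_diag n (\<lambda>i. complex_of_real
                     ((t (i + 1) * inverse (lam (n - i))) powr (1/2)))
                * mat_adjoint U)
           | V U. V \<in> unitary_mats n \<and> U \<in> diagonalizers n \<Delta>}"
    if mono: "\<forall>i\<in>{1..n}. \<forall>j\<in>{1..n}. i \<le> j \<longrightarrow> t j \<le> t i" and inv: "invertible_mat \<Delta>"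
  proof -
    define d where "d = (\<lambda>i. eigval \<Delta> (n - i))"
    have lam: "lam (n - i) = d i" if "i < n" for i using assms(5) that by (simp add: d_def)
    obtain U\<^sub>0 where U\<^sub>0: "U\<^sub>0 \<in> diagonalizers n \<Delta>"
      using hermitian_diagonalizers[OF herm] by blast
    hence "U\<^sub>0 \<in> unitary_mats n" "\<Delta> = conj_diag n U\<^sub>0 d"
      unfolding diagonalizers_iff d_def by blast+
    hence d_pos: "0 < d i" if "i < n" for i
      using inv invertible_conj_diag[of U\<^sub>0 n d] eigval_nonneg[OF assms(4) that] that
      by (simp add: d_def less_le)
    have t_mono: "t (Suc j) \<le> t (Suc i)" if "i \<le> j" "j < n" for i j using mono that by simp
    define c where "c = (\<Prod>i<n. (d i / t (Suc i)) powr t (Suc i)) powr (1 / T)"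
    have "0 < d i / t (Suc i)" if "i < n" for i using that d_pos t by simp
    hence c_pos: "0 < c" and ln_c: "T * ln c = (\<Sum>i<n. t (Suc i) * ln (d i / t (Suc i)))"
      unfolding c_def using T T_pos by (intro ln_weighted_geometric_mean; simp)+
    have "T * ln c = (\<Sum>i<n. t (Suc i) * (ln (d i) - ln (t (Suc i))))"
      unfolding ln_c using d_pos t by (intro sum.cong refl) (force simp: ln_div)
    hence c: "(\<Sum>i<n. t (Suc i)) * ln c = (\<Sum>i<n. t (Suc i) * (ln (d i) - ln (t (Suc i))))"
      by (simp add: T)
    \<comment> \<open>The candidate minimisers, with the scalar factor absorbed into the diagonal.\<close>
    define opt where "opt V U = V * mat_diag n (\<lambda>i. complex_of_real (sqrt (c * t (Suc i) / d i)))
      * mat_adjoint U" for V U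
    have ne: "diagonalizers n \<Delta> \<noteq> {}" using U\<^sub>0 by blast
    note minimum = cost_minimum[where t = t and d = d and c = c,
        OF \<Delta> ne _ d_def _ _ c_pos c, folded opt_def T]
    have lower: "c * T \<le> cost \<Delta> A" if "A \<in> S_mats n t" for A
      by (rule minimum(1)) (use d_pos t t_mono that in auto)
    have opt: "opt V U \<in> S_mats n t" if "V \<in> unitary_mats n" "U \<in> diagonalizers n \<Delta>" for V U
      by (rule minimum(3)) (use d_pos t t_mono that in auto)
    have opt_cost: "cost \<Delta> (opt V U) = c * T"
      if "V \<in> unitary_mats n" "U \<in> diagonalizers n \<Delta>" for V U
      by (rule minimum(4)) (use d_pos t t_mono that in auto)
    have unique: "\<exists>V \<in> unitary_mats n. \<exists>U \<in> diagonalizers n \<Delta>. A = opt V U"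
      if "A \<in> S_mats n t" "cost \<Delta> A = c * T" for A
      by (rule minimum(2)) (use d_pos t t_mono that in auto)
    note opt\<^sub>0 = opt[OF unitary_one U\<^sub>0] opt_cost[OF unitary_one U\<^sub>0]
    have iota: "iota \<Delta> (S_mats n t) = c * T"
    proof (rule antisym)
      show "iota \<Delta> (S_mats n t) \<le> c * T"
        unfolding iota_def opt\<^sub>0(2)[symmetric] using lower opt\<^sub>0(1)
        by (intro cINF_lower bdd_belowI2) auto
      show "c * T \<le> iota \<Delta> (S_mats n t)"
        unfolding iota_def using lower opt\<^sub>0(1) by (intro cINF_greatest) auto
    qed
    have "(\<Prod>j=1..n. (lam (n - j + 1) * inverse (t j)) powr t j)
        = (\<Prod>i<n. (lam (n - Suc i + 1) * inverse (t (Suc i))) powr t (Suc i))"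
      by (rule prod.reindex_bij_witness[of _ Suc "\<lambda>j. j - 1"]) auto
    also have "\<dots> = (\<Prod>i<n. (d i / t (Suc i)) powr t (Suc i))"
    proof (intro prod.cong refl)
      fix i assume "i \<in> {..<n}"
      hence i: "i < n" by simp
      hence "n - Suc i + 1 = n - i" by simp
      thus "(lam (n - Suc i + 1) * inverse (t (Suc i))) powr t (Suc i)
          = (d i / t (Suc i)) powr t (Suc i)"
        by (simp only: lam[OF i] divide_inverse)
    qed
    finally have closed_form: "iota \<Delta> (S_mats n t)
        = T * (\<Prod>j=1..n. (lam (n - j + 1) * inverse (t j)) powr t j) powr (1 / T)"
      by (simp only: iota c_def mult.commute)
    have "T powr (-1/2) * (c * T) powr (1/2) = c powr (1/2) * T powr (-1/2 + 1/2)"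
      using T_pos c_pos unfolding powr_add by (simp add: powr_mult)
    also have "\<dots> = sqrt c"
      using T_pos c_pos by (simp add: powr_half_sqrt)
    finally have scale: "T powr (-1/2) * (c * T) powr (1/2) = sqrt c" .
    have opt_eq: "complex_of_real (T powr (-1/2) * iota \<Delta> (S_mats n t) powr (1/2)) \<cdot>\<^sub>m
        (V * mat_diag n (\<lambda>i. complex_of_real ((t (i + 1) * inverse (lam (n - i))) powr (1/2)))
          * mat_adjoint U) = opt V U"
      if "V \<in> unitary_mats n" "U \<in> diagonalizers n \<Delta>" for V U
    proof -
      have "sqrt c * (t (i + 1) * inverse (lam (n - i))) powr (1/2) = sqrt (c * t (Suc i) / d i)"
        if "i < n" for i
      proof -
        have "0 \<le> t (Suc i) * inverse (d i)" using t[OF that] d_pos[OF that] by simp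
        hence "(t (i + 1) * inverse (lam (n - i))) powr (1/2) = sqrt (t (Suc i) * inverse (d i))"
          unfolding lam[OF that] Suc_eq_plus1[symmetric] by (rule powr_half_sqrt)
        thus ?thesis by (simp only: real_sqrt_mult[symmetric] divide_inverse mult.assoc)
      qed
      hence "mat_diag n (\<lambda>i. complex_of_real (sqrt c)
            * complex_of_real ((t (i + 1) * inverse (lam (n - i))) powr (1/2)))
          = mat_diag n (\<lambda>i. complex_of_real (sqrt (c * t (Suc i) / d i)))"
        by (intro mat_diag_cong) (simp del: of_real_mult flip: of_real_mult)
      moreover have "U \<in> unitary_mats n" using that(2) by (simp add: diagonalizers_iff)
      ultimately show ?thesis
        unfolding iota scale by (simp only: smult_svd[OF that(1)] opt_def)
    qed
    have "minimizers \<Delta> (S_mats n t) = {opt V U | V U. V \<in> unitary_mats n \<and> U \<in> diagonalizers n \<Delta>}"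
      unfolding minimizers_def iota using unique opt opt_cost by blast
    also have "\<dots> = {complex_of_real (T powr (-1/2) * iota \<Delta> (S_mats n t) powr (1/2)) \<cdot>\<^sub>m
             (V * mat_diag n (\<lambda>i. complex_of_real
                     ((t (i + 1) * inverse (lam (n - i))) powr (1/2)))
                * mat_adjoint U)
           | V U. V \<in> unitary_mats n \<and> U \<in> diagonalizers n \<Delta>}"
      by (intro Collect_cong ex_cong1 rev_conj_cong refl) (simp only: opt_eq)
    finally have mins: "minimizers \<Delta> (S_mats n t) = \<dots>" .
    have "attained \<Delta> (S_mats n t)"
    proof -
      have "opt (1\<^sub>m n) U\<^sub>0 \<in> minimizers \<Delta> (S_mats n t)"
        using opt\<^sub>0 by (simp add: minimizers_def iota)
      thus ?thesis unfolding attained_def by (rule ex_in_conv[THEN iffD1, OF exI])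
    qed
    thus ?thesis by (intro conjI closed_form mins)
  qed
  have "iota \<Delta> (S_mats n t) = 0 \<and> (attained \<Delta> (S_mats n t) \<longleftrightarrow> \<Delta> = 0\<^sub>m n n)"
    if "\<not> invertible_mat \<Delta>"
    using iota_singular[of n t \<Delta>] assms(1) t assms(4) that by simp
  thus ?thesis by (intro conjI[OF impI] impI regular)
qed

end
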